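(* Let $G$ be a compact group and $\alpha$ an automorphism of $G$ such that the pair $(G,\alpha)$ is topologically transitive and has finite depth. Then any two subnormal series for $(G,\alpha)$ (consisting of closed, $\alpha$-stable, topologically transitive subgroups of $G$) have equivalent refinements.
   Context: All groups are Hausdorff topological groups and automorphisms are automorphisms of topological groups. A subgroup $H$ is $\alpha$-stable if $\alpha(H)=H$. A pair $(K,\beta)$ with $K$ compact and $\beta\in\mathrm{Aut}(K)$ is topologically transitive if there is $x\in K$ whose orbit $\{\beta^n(x): n\in\mathbb{Z}\}$ is dense in $K$; a closed $\alpha$-stable subgroup $H$ is called topologically transitive if $(H,\alpha|_H)$ is. The pair $(G,\alpha)$ has finite depth if there is an open subgroup $V\le G$ with $\bigcap_{k\in\mathbb{Z}}\alpha^k(V)=\{1\}$. A subnormal series for $(G,\alpha)$ is a sequence $\{1\}=G_0\le G_1\le\cdots\le G_r=G$ of closed, $\alpha$-stable, topologically transitive subgroups such that, for each $j\in\{1,\dots,r\}$, $G_{j-1}$ is normal in $G_j$ and the automorphism $\alpha_j$ induced by $\alpha$ on $G_j/G_{j-1}$ is topologically transitive; the pairs $(G_j/G_{j-1},\alpha_j)$ are its subquotients. A refinement of a subnormal series is a subnormal series in which all the subgroups of the original series appear, possibly together with others. Two pairs $(G_1,\alpha_1)$, $(G_2,\alpha_2)$ (compact groups with automorphisms) are co-commensurable if there is a compact group $H$ with automorphism $\beta$ and surjective continuous homomorphisms $\varphi_i:H\to G_i$ with finite kernels satisfying $\varphi_i\circ\beta=\alpha_i\circ\varphi_i$ for $i=1,2$.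 Two subnormal series $\{1\}=G_0\le\cdots\le G_r=G$ and $\{1\}=H_0\le\cdots\le H_s=G$ are equivalent if $r=s$ and there is a permutation $\pi$ of $\{1,\dots,r\}$ such that each subquotient $(G_j/G_{j-1},\alpha_j)$ is co-commensurable with $(H_{\pi(j)}/H_{\pi(j)-1},\alpha'_{\pi(j)})$, where $\alpha'_i$ denotes the induced automorphism on $H_i/H_{i-1}$. *)

theory Defs
  imports "HOL-Analysis.Analysis" "HOL-Algebra.Coset"
begin

definition topgroup :: "('a, 'm) monoid_scheme \<Rightarrow> 'a topology \<Rightarrow> bool" where
  "topgroup G X \<longleftrightarrow> group G \<and> topspace X = carrier G \<and> Hausdorff_space X \<and>
     continuous_map (prod_topology X X) X (\<lambda>(x, y). mult G x y) \<and>
     continuous_map X X (\<lambda>x. m_inv G x)"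

definition topaut :: "('a, 'm) monoid_scheme \<Rightarrow> 'a topology \<Rightarrow> ('a \<Rightarrow> 'a) \<Rightarrow> bool" where
  "topaut G X f \<longleftrightarrow> f \<in> iso G G \<and> homeomorphic_map X X f"

definition zpow_map :: "'a set \<Rightarrow> ('a \<Rightarrow> 'a) \<Rightarrow> int \<Rightarrow> 'a \<Rightarrow> 'a" where
  "zpow_map A f k = (if 0 \<le> k then f ^^ nat k else inv_into A f ^^ nat (- k))"

definition top_transitive :: "'a topology \<Rightarrow> ('a \<Rightarrow> 'a) \<Rightarrow> bool" where
  "top_transitive X f \<longleftrightarrow>
     (\<exists>x \<in> topspace X. X closure_of {zpow_map (topspace X) f k x | k. True} = topspace X)"

definition finite_depth :: "('a, 'm) monoid_scheme \<Rightarrow> 'a topology \<Rightarrow> ('a \<Rightarrow> 'a) \<Rightarrow> bool" where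
  "finite_depth G X f \<longleftrightarrow>
     (\<exists>V. subgroup V G \<and> openin X V \<and>
          (\<Inter>k::int. zpow_map (carrier G) f k ` V) = {one G})"

definition qtop :: "'a topology \<Rightarrow> ('a \<Rightarrow> 'b) \<Rightarrow> 'b topology" where
  "qtop X q = topology (\<lambda>U. U \<subseteq> q ` topspace X \<and> openin X {x \<in> topspace X. q x \<in> U})"

definition sq_group :: "('a, 'm) monoid_scheme \<Rightarrow> (nat \<Rightarrow> 'a set) \<Rightarrow> nat \<Rightarrow> 'a set monoid" where
  "sq_group G S j = (G\<lparr>carrier := S j\<rparr>) Mod (S (j - 1))"

definition sq_top :: "('a, 'm) monoid_scheme \<Rightarrow> 'a topology \<Rightarrow> (nat \<Rightarrow> 'a set) \<Rightarrow> nat \<Rightarrow> 'a set topology" where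
  "sq_top G X S j = qtop (subtopology X (S j)) (\<lambda>x. S (j - 1) #>\<^bsub>G\<^esub> x)"

definition sq_map :: "('a \<Rightarrow> 'a) \<Rightarrow> 'a set \<Rightarrow> 'a set" where
  "sq_map f C = f ` C"

definition subnormal_series ::
  "('a, 'm) monoid_scheme \<Rightarrow> 'a topology \<Rightarrow> ('a \<Rightarrow> 'a) \<Rightarrow> (nat \<Rightarrow> 'a set) \<Rightarrow> nat \<Rightarrow> bool" where
  "subnormal_series G X f S r \<longleftrightarrow>
     S 0 = {one G} \<and> S r = carrier G \<and>
     (\<forall>j \<le> r. subgroup (S j) G \<and> closedin X (S j) \<and> f ` S j = S j \<and>
               top_transitive (subtopology X (S j)) f) \<and>
     (\<forall>j \<in> {1..r}. S (j - 1) \<subseteq> S j \<and> S (j - 1) \<lhd> G\<lparr>carrier := S j\<rparr> \<and>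
               top_transitive (sq_top G X S j) (sq_map f))"

definition refines_series ::
  "('a, 'm) monoid_scheme \<Rightarrow> 'a topology \<Rightarrow> ('a \<Rightarrow> 'a) \<Rightarrow> (nat \<Rightarrow> 'a set) \<Rightarrow> nat \<Rightarrow> (nat \<Rightarrow> 'a set) \<Rightarrow> nat \<Rightarrow> bool" where
  "refines_series G X f R m S r \<longleftrightarrow> subnormal_series G X f R m \<and> (\<forall>i \<le> r. \<exists>j \<le> m. S i = R j)"

text \<open>The witnessing compact group H is taken with carrier in the product type 'b \<times> 'c
  (HOL cannot quantify over types inside a formula); this loses nothing, since the
  image of any witness under (\<phi>1, \<phi>2) is again a witness.\<close>
definition co_commensurable ::
  "'b monoid \<Rightarrow> 'b topology \<Rightarrow> ('b \<Rightarrow> 'b) \<Rightarrow> 'c monoid \<Rightarrow> 'c topology \<Rightarrow> ('c \<Rightarrow> 'c) \<Rightarrow> bool" where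
  "co_commensurable G1 X1 f1 G2 X2 f2 \<longleftrightarrow>
     (\<exists>(H :: ('b \<times> 'c) monoid) (Y :: ('b \<times> 'c) topology) \<beta> \<phi>1 \<phi>2.
        topgroup H Y \<and> compact_space Y \<and> topaut H Y \<beta> \<and>
        \<phi>1 \<in> hom H G1 \<and> continuous_map Y X1 \<phi>1 \<and> \<phi>1 ` carrier H = carrier G1 \<and>
        finite (kernel H G1 \<phi>1) \<and> (\<forall>x \<in> carrier H. \<phi>1 (\<beta> x) = f1 (\<phi>1 x)) \<and>
        \<phi>2 \<in> hom H G2 \<and> continuous_map Y X2 \<phi>2 \<and> \<phi>2 ` carrier H = carrier G2 \<and>
        finite (kernel H G2 \<phi>2) \<and> (\<forall>x \<in> carrier H. \<phi>2 (\<beta> x) = f2 (\<phi>2 x)))"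

definition equivalent_series ::
  "('a, 'm) monoid_scheme \<Rightarrow> 'a topology \<Rightarrow> ('a \<Rightarrow> 'a) \<Rightarrow> (nat \<Rightarrow> 'a set) \<Rightarrow> nat \<Rightarrow> (nat \<Rightarrow> 'a set) \<Rightarrow> nat \<Rightarrow> bool" where
  "equivalent_series G X f S r R s \<longleftrightarrow> r = s \<and>
     (\<exists>\<pi>. \<pi> permutes {1..r} \<and>
        (\<forall>j \<in> {1..r}. co_commensurable
            (sq_group G S j) (sq_top G X S j) (sq_map f)
            (sq_group G R (\<pi> j)) (sq_top G X R (\<pi> j)) (sq_map f)))"

end

theory Submission
  imports Defs
begin

text \<open>
  By finite depth there is an open normal subgroup \<open>N\<close> whose translates under \<open>\<alpha>\<close> meet trivially, so
  \<open>x\<close> is determined by the bi-infinite word of the cosets \<open>N #> \<alpha>\<^sup>k(x)\<close> over the finite group \<open>G Mod N\<close>,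
  and \<open>G\<close> is a group subshift. For a closed \<open>\<alpha>\<close>-stable subgroup \<open>K\<close> let \<open>nub K\<close> be the closure
  of the elements of \<open>K\<close> that \<open>\<alpha>\<close> contracts to the identity. A pigeonhole argument on words together
  with the finite type property shows that \<open>nub K\<close> is open in \<open>K\<close>, hence of finite index, and that \<open>K\<close>
  is topologically transitive iff \<open>nub K = K\<close>. In the Schreier refinement
  \<open>S\<^sub>j (S\<^sub>j\<^sub>+\<^sub>1 \<inter> S'\<^sub>i)\<close> one replaces the intersection by its nub. The subquotients obtained
  from the two series are then quotients of the same group \<open>nub (S\<^sub>j\<^sub>+\<^sub>1 \<inter> S'\<^sub>i\<^sub>+\<^sub>1)\<close> by subgroups
  that both contain \<open>nub (S\<^sub>j \<inter> S'\<^sub>i\<^sub>+\<^sub>1) nub (S\<^sub>j\<^sub>+\<^sub>1 \<inter> S'\<^sub>i)\<close> as a subset of finite index.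
\<close>

subsection \<open>Powers of a bijection and quotient topologies\<close>

text \<open>Schreier's construction is built from intersections such as
  \<open>S j \<inter> S' i\<close>, and topological transitivity does not pass to intersections. The
  nub is the largest transitive subgroup that can stand in for such an intersection; the price is a
  finite index, which is why the matched factors agree only up to finite kernels instead of being
  isomorphic. The substitution rests on two facts. The finite type property, and with it finite
  index, holds for every closed stable subgroup, transitive or not. Normality survives because
  \<open>N\<close> is normal: the symbols are elements of a finite group, conjugation acts on words
  letter by letter, and a trivial tail stays trivial. Contraction is required in the forward
  direction only. An element with trivial past need not contract forward, and the recurrence of
  finite windows is what lets it be approximated by elements that do.\<close>

lemma zpow_map_plus1:
  assumes f: "bij_betw f A A" and x: "x \<in> A"
  shows "zpow_map A f (k + 1) x = f (zpow_map A f k x)"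
proof -
  have g: "bij_betw (inv_into A f) A A"
    using f by (rule bij_betw_inv_into)
  then have "inv_into A f y \<in> A" if "y \<in> A" for y
    using that bij_betwE by blast
  then have gp: "(inv_into A f ^^ n) x \<in> A" for n
    by (induction n) (use x in auto)
  consider "k \<ge> 0" | "k < 0" by linarith
  then show ?thesis
  proof cases
    case 1
    then have "nat (k + 1) = Suc (nat k)" by simp
    with 1 show ?thesis by (simp add: zpow_map_def)
  next
    case 2
    then obtain n where n: "nat (- k) = Suc n"
      by (metis gr0_implies_Suc neg_0_less_iff_less zero_less_nat_eq)
    have "f (zpow_map A f k x) = (inv_into A f ^^ n) x"
      using 2 n gp f by (simp add: zpow_map_def bij_betw_inv_into_right)
    moreover have "zpow_map A f (k + 1) x = (inv_into A f ^^ n) x"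
    proof (cases "k = -1")
      case True
      then show ?thesis using n by (simp add: zpow_map_def)
    next
      case False
      then have "nat (- (k + 1)) = n" "\<not> 0 \<le> k + 1" using 2 n by linarith+
      then show ?thesis by (simp add: zpow_map_def)
    qed
    ultimately show ?thesis by simp
  qed
qed

lemma zpow_map_0 [simp]: "zpow_map A f 0 x = x"
  by (simp add: zpow_map_def)

lemma zpow_map_in:
  assumes f: "bij_betw f A A" and x: "x \<in> A"
  shows "zpow_map A f k x \<in> A"
proof -
  have "bij_betw (inv_into A f) A A"
    using f by (rule bij_betw_inv_into)
  then have "inv_into A f y \<in> A" "f y \<in> A" if "y \<in> A" for y
    using that f bij_betwE by blast+
  then have "(inv_into A f ^^ n) x \<in> A" "(f ^^ n) x \<in> A" for n
    by (induction n) (use x in auto)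
  then show ?thesis by (simp add: zpow_map_def)
qed

text \<open>The recursion determines the sequence from its value at 0, by injectivity of
  \<open>f\<close> in the negative direction. Additivity, intertwining and multiplicativity of
  integer powers follow by checking the recursion, which avoids case splits on signs.\<close>

lemma zpow_map_unique:
  assumes f: "bij_betw f A A" and hA: "\<And>k. h k \<in> A" and h: "\<And>k. h (k + 1) = f (h k)"
  shows "h k = zpow_map A f k (h 0)"
proof (induction k rule: int_induct[where k = 0])
  case base
  then show ?case by simp
next
  case (step1 i)
  then show ?case using h zpow_map_plus1[OF f hA] by simp
next
  case (step2 i)
  have "f (h (i - 1)) = f (zpow_map A f (i - 1) (h 0))"
    using h[of "i - 1"] zpow_map_plus1[OF f hA, of "i - 1" 0] step2 by simp
  then show ?case
    using f hA zpow_map_in[OF f hA] by (meson bij_betw_imp_inj_on inj_onD)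
qed

lemma zpow_map_add:
  assumes f: "bij_betw f A A" and x: "x \<in> A"
  shows "zpow_map A f (i + j) x = zpow_map A f i (zpow_map A f j x)"
  using zpow_map_unique[OF f, of "\<lambda>i. zpow_map A f (i + j) x" i]
    zpow_map_plus1[OF f x, of "_ + j"] zpow_map_in[OF f x] by (simp add: add.assoc add.commute[of 1])

lemma zpow_map_semiconj:
  assumes f: "bij_betw f A A" and g: "bij_betw g B B" and q: "\<And>x. x \<in> A \<Longrightarrow> q x \<in> B"
    and comm: "\<And>x. x \<in> A \<Longrightarrow> q (f x) = g (q x)" and x: "x \<in> A"
  shows "q (zpow_map A f k x) = zpow_map B g k (q x)"
  using zpow_map_unique[OF g, of "\<lambda>k. q (zpow_map A f k x)" k] zpow_map_plus1[OF f x]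
    zpow_map_in[OF f x] q comm by simp

lemma continuous_map_zpow_map:
  assumes f: "homeomorphic_map X X f"
  shows "continuous_map X X (zpow_map (topspace X) f k)"
proof -
  have pow: "continuous_map X X (h ^^ n)" if "continuous_map X X h" for h :: "'a \<Rightarrow> 'a" and n
  proof (induction n)
    case (Suc n)
    then show ?case using continuous_map_compose[OF Suc that] by (simp add: o_def)
  qed simp
  obtain g where g: "homeomorphic_maps X X f g"
    using f homeomorphic_map_maps by blast
  have inj: "inj_on f (topspace X)"
    using f by (simp add: homeomorphic_eq_everything_map)
  have gc: "continuous_map X X g" and fg: "\<And>y. y \<in> topspace X \<Longrightarrow> f (g y) = y"
    using g unfolding homeomorphic_maps_def by auto
  have "g y = inv_into (topspace X) f y" if "y \<in> topspace X" for y
  proof -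
    have "g y \<in> topspace X" using gc that by (auto simp: continuous_map_def)
    then show ?thesis using inv_into_f_f[OF inj, of "g y"] fg[OF that] by simp
  qed
  then have "continuous_map X X (inv_into (topspace X) f)"
    by (rule continuous_map_eq[OF gc])
  then show ?thesis
    using pow f unfolding zpow_map_def by (simp add: homeomorphic_imp_continuous_map)
qed

text \<open>\<open>topology\<close> returns the intended object only for a family satisfying
  \<open>istopology\<close>; preimages commute with unions and intersections, so this one
  does.\<close>

lemma openin_qtop:
  "openin (qtop X q) U \<longleftrightarrow> U \<subseteq> q ` topspace X \<and> openin X {x \<in> topspace X. q x \<in> U}"
proof -
  have "istopology (\<lambda>U. U \<subseteq> q ` topspace X \<and> openin X {x \<in> topspace X. q x \<in> U})"
    unfolding istopology_def
  proof (intro conjI allI impI)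
    fix S T
    assume "S \<subseteq> q ` topspace X \<and> openin X {x \<in> topspace X. q x \<in> S}"
      "T \<subseteq> q ` topspace X \<and> openin X {x \<in> topspace X. q x \<in> T}"
    moreover have "{x \<in> topspace X. q x \<in> S \<inter> T} =
        {x \<in> topspace X. q x \<in> S} \<inter> {x \<in> topspace X. q x \<in> T}" by auto
    ultimately show "S \<inter> T \<subseteq> q ` topspace X" "openin X {x \<in> topspace X. q x \<in> S \<inter> T}"
      by auto
  next
    fix \<K>
    assume K: "\<forall>K\<in>\<K>. K \<subseteq> q ` topspace X \<and> openin X {x \<in> topspace X. q x \<in> K}"
    then show "\<Union>\<K> \<subseteq> q ` topspace X" by auto
    have "{x \<in> topspace X. q x \<in> \<Union>\<K>} = (\<Union>K\<in>\<K>. {x \<in> topspace X. q x \<in> K})" by auto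
    then show "openin X {x \<in> topspace X. q x \<in> \<Union>\<K>}" using K by (simp add: openin_clauses(3))
  qed
  then show ?thesis by (simp add: qtop_def)
qed

lemma topspace_qtop [simp]: "topspace (qtop X q) = q ` topspace X"
proof
  show "topspace (qtop X q) \<subseteq> q ` topspace X"
    using openin_qtop[of X q "topspace (qtop X q)"] by simp
  have "{x \<in> topspace X. q x \<in> q ` topspace X} = topspace X" by auto
  then show "q ` topspace X \<subseteq> topspace (qtop X q)"
    using openin_qtop[of X q "q ` topspace X"] openin_subset[of "qtop X q"] by simp
qed

lemma quotient_map_qtop: "quotient_map X (qtop X q) q"
  by (auto simp: quotient_map_def openin_qtop)

text \<open>By \<open>zpow_map_semiconj\<close> the image of an orbit is an orbit, and continuity
  sends the closure of the first into the closure of the second.\<close>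

lemma top_transitive_image:
  assumes f: "bij_betw f (topspace X) (topspace X)" and g: "bij_betw g (topspace Y) (topspace Y)"
    and q: "continuous_map X Y q" and surj: "q ` topspace X = topspace Y"
    and comm: "\<And>x. x \<in> topspace X \<Longrightarrow> q (f x) = g (q x)"
    and tt: "top_transitive X f"
  shows "top_transitive Y g"
proof -
  obtain x where x: "x \<in> topspace X"
    and cl: "X closure_of {zpow_map (topspace X) f k x | k. True} = topspace X"
    using tt unfolding top_transitive_def by blast
  have "q (zpow_map (topspace X) f k x) = zpow_map (topspace Y) g k (q x)" for k
  proof (rule zpow_map_semiconj[OF f g])
    show "q y \<in> topspace Y" if "y \<in> topspace X" for y using that surj by auto
  qed (use comm x in auto)
  then have "q ` {zpow_map (topspace X) f k x | k. True} = {zpow_map (topspace Y) g k (q x) | k. True}"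
    by (auto simp: image_iff) metis
  moreover have "q ` (X closure_of {zpow_map (topspace X) f k x | k. True})
      \<subseteq> Y closure_of (q ` {zpow_map (topspace X) f k x | k. True})"
    using q by (rule continuous_map_image_closure_subset)
  ultimately have "topspace Y \<subseteq> Y closure_of {zpow_map (topspace Y) g k (q x) | k. True}"
    using cl surj by simp
  then have "Y closure_of {zpow_map (topspace Y) g k (q x) | k. True} = topspace Y"
    by (simp add: closure_of_subset_topspace subset_antisym)
  moreover have "q x \<in> topspace Y" using x surj by auto
  ultimately show ?thesis
    unfolding top_transitive_def by blast
qed

subsection \<open>Compact topological groups\<close>

lemma (in group) inv_mult_cancel:
  assumes "x \<in> carrier G" "y \<in> carrier G"
  shows "inv x \<otimes> (x \<otimes> y) = y" "x \<otimes> (inv x \<otimes> y) = y"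
  using assms by (simp_all add: m_assoc[symmetric])

lemma (in group) subgroup_set_mult:
  assumes K: "subgroup K G" and L: "subgroup L G"
    and norm: "\<And>k l. k \<in> K \<Longrightarrow> l \<in> L \<Longrightarrow> l \<otimes> k \<otimes> inv l \<in> K"
  shows "subgroup (K <#> L) G"
proof -
  note sub = subgroup.mem_carrier[OF K] subgroup.mem_carrier[OF L]
  show ?thesis
  proof (rule subgroupI)
    show "K <#> L \<subseteq> carrier G" using sub by (auto simp: set_mult_def)
    show "K <#> L \<noteq> {}"
      using subgroup.one_closed[OF K] subgroup.one_closed[OF L] by (auto simp: set_mult_def)
  next
    fix a assume "a \<in> K <#> L"
    then obtain k l where kl: "k \<in> K" "l \<in> L" "a = k \<otimes> l" by (auto simp: set_mult_def)
    then have "inv a = (inv l \<otimes> inv k \<otimes> inv (inv l)) \<otimes> inv l"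
      using sub by (simp add: inv_mult_group m_assoc)
    moreover have "inv l \<otimes> inv k \<otimes> inv (inv l) \<in> K"
      using kl K L norm subgroup.m_inv_closed by metis
    ultimately show "inv a \<in> K <#> L"
      using kl(2) L subgroup.m_inv_closed unfolding set_mult_def by fastforce
  next
    fix a b assume "a \<in> K <#> L" "b \<in> K <#> L"
    then obtain k l k' l' where kl: "k \<in> K" "l \<in> L" "a = k \<otimes> l" "k' \<in> K" "l' \<in> L" "b = k' \<otimes> l'"
      by (auto simp: set_mult_def)
    then have "a \<otimes> b = (k \<otimes> (l \<otimes> k' \<otimes> inv l)) \<otimes> (l \<otimes> l')"
      using sub by (simp add: m_assoc inv_mult_cancel)
    moreover have "k \<otimes> (l \<otimes> k' \<otimes> inv l) \<in> K" "l \<otimes> l' \<in> L"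
      using kl norm K L by (simp_all add: subgroup.m_closed)
    ultimately show "a \<otimes> b \<in> K <#> L" unfolding set_mult_def by blast
  qed
qed

locale compact_topgroup = group G for G (structure) +
  fixes X :: "'a topology"
  assumes topgroup: "topgroup G X" and compact: "compact_space X"
begin

lemma topspace_eq [simp]: "topspace X = carrier G"
  and Hausdorff: "Hausdorff_space X"
  using topgroup by (simp_all add: topgroup_def)

lemma continuous_mult:
  assumes "continuous_map Z X f" "continuous_map Z X g"
  shows "continuous_map Z X (\<lambda>z. f z \<otimes> g z)"
proof -
  have "continuous_map (prod_topology X X) X (\<lambda>(x, y). x \<otimes> y)"
    using topgroup by (simp add: topgroup_def)
  moreover have "continuous_map Z (prod_topology X X) (\<lambda>z. (f z, g z))"
    using assms by (simp add: continuous_map_paired)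
  ultimately show ?thesis
    using continuous_map_compose[of Z "prod_topology X X" "\<lambda>z. (f z, g z)" X "\<lambda>(x, y). x \<otimes> y"]
    by (simp add: o_def)
qed

lemma continuous_inv:
  assumes "continuous_map Z X f"
  shows "continuous_map Z X (\<lambda>z. inv (f z))"
  using topgroup continuous_map_compose[OF assms] by (fastforce simp: o_def topgroup_def)

lemma openin_rcoset:
  assumes "openin X U" "g \<in> carrier G"
  shows "openin X (U #> g)"
proof -
  have "continuous_map X X (\<lambda>x. x \<otimes> inv g)"
    using assms by (intro continuous_mult) auto
  then have "openin X {x \<in> topspace X. x \<otimes> inv g \<in> U}"
    using assms(1) by (rule openin_continuous_map_preimage)
  moreover have "{x \<in> topspace X. x \<otimes> inv g \<in> U} = U #> g"
  proof -
    have "x \<in> U #> g" if "x \<in> carrier G" "x \<otimes> inv g \<in> U" for x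
      using that assms(2) unfolding r_coset_def
      by (auto intro!: bexI[of _ "x \<otimes> inv g"] simp: m_assoc)
    then show ?thesis
      using assms openin_subset[OF assms(1)] by (auto simp: r_coset_def m_assoc subset_iff)
  qed
  ultimately show ?thesis by simp
qed

text \<open>The cosets are open and pairwise disjoint, so a finite subcover must contain every one
  of them.\<close>

lemma finite_rcosets_open:
  assumes U: "subgroup U G" "openin X U"
  shows "finite (rcosets U)"
proof -
  have "\<forall>C \<in> rcosets U. openin X C"
    using openin_rcoset[OF U(2)] by (auto simp: RCOSETS_def)
  moreover have "topspace X \<subseteq> \<Union>(rcosets U)"
    using rcosets_part_G[OF U(1)] by simp
  ultimately obtain F where F: "finite F" "F \<subseteq> rcosets U" "topspace X \<subseteq> \<Union>F"
    using compact unfolding compact_space_alt by meson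
  have "rcosets U \<subseteq> F"
  proof
    fix C assume C: "C \<in> rcosets U"
    then obtain x where x: "x \<in> C" "x \<in> carrier G"
      using subgroup.rcosets_non_empty[OF U(1) C] rcosets_part_G[OF U(1)] by blast
    then obtain D where D: "D \<in> F" "x \<in> D" using F(3) by auto
    then have "C = D"
      using rcos_disjoint[OF U(1)] C F(2) x by (metis IntI disjnt_def emptyE pairwiseD subsetD)
    then show "C \<in> F" using D by simp
  qed
  then show ?thesis using F(1) finite_subset by blast
qed

text \<open>Compactness of \<open>K \<times> L\<close> passes to its image under multiplication. The
  result is used for saturations of closed sets under a quotient map and for products of stable
  subgroups.\<close>

lemma closedin_set_mult:
  assumes "closedin X K" "closedin X L"
  shows "closedin X (K <#> L)"
proof -
  have "compactin (prod_topology X X) (K \<times> L)"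
    using assms closedin_compact_space[OF compact] by (simp add: compactin_Times)
  then have "compactin X ((\<lambda>(x, y). x \<otimes> y) ` (K \<times> L))"
    using topgroup image_compactin unfolding topgroup_def by blast
  moreover have "(\<lambda>(x, y). x \<otimes> y) ` (K \<times> L) = K <#> L"
    by (force simp: set_mult_def)
  ultimately show ?thesis
    using Hausdorff compactin_imp_closedin by metis
qed

lemma topgroup_subgroup:
  assumes H: "subgroup H G"
  shows "topgroup (G\<lparr>carrier := H\<rparr>) (subtopology X H)"
proof -
  have sub: "topspace X \<inter> H = H" using subgroup.subset[OF H] by auto
  have fst: "continuous_map (prod_topology (subtopology X H) (subtopology X H)) X fst"
    and snd: "continuous_map (prod_topology (subtopology X H) (subtopology X H)) X snd"
    using continuous_map_fst continuous_map_snd continuous_map_into_fulltopology by blast+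
  have "continuous_map (prod_topology (subtopology X H) (subtopology X H)) (subtopology X H)
      (\<lambda>z. fst z \<otimes> snd z)"
    using continuous_mult[OF fst snd] subgroup.m_closed[OF H]
    by (auto simp: continuous_map_in_subtopology)
  moreover have "continuous_map (subtopology X H) (subtopology X H) (\<lambda>x. inv x)"
    using continuous_inv[of "subtopology X H" "\<lambda>x. x"] subgroup.m_inv_closed[OF H]
    by (auto simp: continuous_map_in_subtopology)
  then have "continuous_map (subtopology X H) (subtopology X H) (\<lambda>x. inv\<^bsub>G\<lparr>carrier := H\<rparr>\<^esub> x)"
    by (rule continuous_map_eq) (use m_inv_consistent[OF H] in auto)
  ultimately show ?thesis
    unfolding topgroup_def using sub Hausdorff subgroup.subgroup_is_group[OF H is_group]
    by (simp add: Hausdorff_space_subtopology case_prod_unfold)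
qed

lemma closed_subgroup_compact_topgroup:
  assumes H: "subgroup H G" "closedin X H"
  shows "compact_topgroup (G\<lparr>carrier := H\<rparr>) (subtopology X H)"
proof -
  interpret H: group "G\<lparr>carrier := H\<rparr>"
    using H(1) is_group by (rule subgroup.subgroup_is_group)
  show ?thesis
    using topgroup_subgroup[OF H(1)] closedin_compact_space[OF compact H(2)]
    by unfold_locales (simp_all add: compact_space_subtopology)
qed

text \<open>The saturation of a closed \<open>C\<close> is the product of the kernel with
  \<open>C\<close>, so \<open>q\<close> is a closed map; hence points are closed in the quotient,
  and normality of \<open>X\<close> makes the quotient Hausdorff. \<open>K\<close> carries no
  topology of its own; the image of \<open>q\<close> receives the quotient topology.\<close>

lemma compact_topgroup_image:
  assumes hom: "group_hom G K q" and ker: "closedin X (kernel G K q)"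
  shows "compact_topgroup (K\<lparr>carrier := q ` carrier G\<rparr>) (qtop X q)"
proof -
  interpret q: group_hom G K q by fact
  let ?K = "K\<lparr>carrier := q ` carrier G\<rparr>" and ?Y = "qtop X q"
  have quo: "quotient_map X ?Y q" by (rule quotient_map_qtop)
  have cont: "continuous_map X ?Y q" using quo by (rule quotient_imp_continuous_map)
  have sat: "{x \<in> topspace X. q x \<in> q ` C} = kernel G K q <#> C" if "C \<subseteq> carrier G" for C
  proof -
    have "\<exists>k\<in>kernel G K q. \<exists>c\<in>C. x = k \<otimes> c" if "x \<in> carrier G" "c \<in> C" "q x = q c" for x c
      using that \<open>C \<subseteq> carrier G\<close>
      by (intro bexI[of _ "x \<otimes> inv c"] bexI[of _ c]) (auto simp: kernel_def m_assoc)
    then show ?thesis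
      using that by (fastforce simp: set_mult_def kernel_def)
  qed
  have closed: "closed_map X ?Y q"
    unfolding closed_map_def
  proof (intro allI impI)
    fix C assume C: "closedin X C"
    then have "closedin X {x \<in> topspace X. q x \<in> q ` C}"
      using sat[of C] closedin_subset[OF C] closedin_set_mult[OF ker C] by simp
    moreover have "q ` C \<subseteq> topspace ?Y" using closedin_subset[OF C] by auto
    ultimately show "closedin ?Y (q ` C)"
      using quo unfolding quotient_map_closedin by blast
  qed
  have "normal_space X"
    using compact Hausdorff compact_Hausdorff_or_regular_imp_normal_space by blast
  moreover have "t1_space ?Y"
    unfolding t1_space_closedin_singleton
  proof
    fix y assume "y \<in> topspace ?Y"
    then obtain x where x: "x \<in> carrier G" "y = q x" by auto
    then have "closedin X {x}"
      using Hausdorff by (simp add: Hausdorff_imp_t1_space closedin_t1_singleton)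
    then show "closedin ?Y {y}"
      using closed x(2) unfolding closed_map_def by fastforce
  qed
  ultimately have HY: "Hausdorff_space ?Y"
    using closed cont Hausdorff_normal_space_closed_continuous_map_image by fastforce
  have comp: "compact_space ?Y"
    using image_compactin[OF _ cont, of "topspace X"] compact by (simp add: compact_space_def)
  interpret Y: group ?K
    using q.img_is_subgroup q.H.is_group by (rule subgroup.subgroup_is_group)
  let ?qq = "\<lambda>z. (q (fst z), q (snd z))"
  have "continuous_map (prod_topology X X) (prod_topology ?Y ?Y) ?qq"
    using continuous_map_compose[OF continuous_map_fst[of X X] cont]
      continuous_map_compose[OF continuous_map_snd[of X X] cont]
    by (simp add: continuous_map_paired o_def)
  \<comment> \<open>A product of quotient maps need not be a quotient map; this one is, being a
    continuous surjection from a compact space onto a Hausdorff space. Multiplication then descends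
    along it.\<close>
  then have qq: "quotient_map (prod_topology X X) (prod_topology ?Y ?Y) ?qq"
    using compact HY by (intro continuous_imp_quotient_map)
      (auto simp: compact_space_prod_topology Hausdorff_space_prod_topology image_iff)
  have "continuous_map (prod_topology X X) X (\<lambda>z. fst z \<otimes> snd z)"
    by (intro continuous_mult continuous_map_fst continuous_map_snd)
  then have "continuous_map (prod_topology X X) ?Y (\<lambda>z. q (fst z \<otimes> snd z))"
    using continuous_map_compose[OF _ cont] by (fastforce simp: o_def)
  then have "continuous_map (prod_topology X X) ?Y ((\<lambda>(x, y). x \<otimes>\<^bsub>K\<^esub> y) \<circ> ?qq)"
    by (rule continuous_map_eq) auto
  then have mult: "continuous_map (prod_topology ?Y ?Y) ?Y (\<lambda>(x, y). x \<otimes>\<^bsub>K\<^esub> y)"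
    by (rule continuous_compose_quotient_map[OF qq])
  have "continuous_map X ?Y (\<lambda>x. q (inv x))"
    using continuous_map_compose[OF continuous_inv[of X "\<lambda>x. x"] cont] by (simp add: o_def)
  then have "continuous_map X ?Y ((\<lambda>y. inv\<^bsub>?K\<^esub> y) \<circ> q)"
    by (rule continuous_map_eq) (auto simp: q.H.m_inv_consistent[OF q.img_is_subgroup])
  then have "continuous_map ?Y ?Y (\<lambda>y. inv\<^bsub>?K\<^esub> y)"
    by (rule continuous_compose_quotient_map[OF quo])
  then have "topgroup ?K ?Y"
    using mult HY Y.is_group by (simp add: topgroup_def)
  then show ?thesis
    using comp by unfold_locales
qed

end

subsection \<open>Symbolic coding of an expansive automorphism\<close>

locale expansive_group = compact_topgroup G X for G (structure) and X :: "'a topology" +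
  fixes \<alpha> :: "'a \<Rightarrow> 'a" and N :: "'a set"
  assumes aut: "topaut G X \<alpha>" and normal_N: "N \<lhd> G" and open_N: "openin X N"
    and expansive: "(\<Inter>k::int. zpow_map (carrier G) \<alpha> k ` N) = {\<one>}"
begin

definition act :: "int \<Rightarrow> 'a \<Rightarrow> 'a" where
  "act k = zpow_map (carrier G) \<alpha> k"

definition symb :: "int \<Rightarrow> 'a \<Rightarrow> 'a set" where
  "symb k x = N #> act k x"

abbreviation Q where "Q \<equiv> G Mod N"

lemma bij_aut: "bij_betw \<alpha> (carrier G) (carrier G)"
  using aut by (simp add: topaut_def iso_def)

lemma aut_mult: "x \<in> carrier G \<Longrightarrow> y \<in> carrier G \<Longrightarrow> \<alpha> (x \<otimes> y) = \<alpha> x \<otimes> \<alpha> y"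
  using aut by (simp add: topaut_def iso_def hom_def)

lemma act_closed [simp]: "x \<in> carrier G \<Longrightarrow> act k x \<in> carrier G"
  unfolding act_def by (rule zpow_map_in[OF bij_aut])

lemma act_0 [simp]: "act 0 x = x"
  by (simp add: act_def)

lemma act_act [simp]: "x \<in> carrier G \<Longrightarrow> act i (act j x) = act (i + j) x"
  unfolding act_def by (rule zpow_map_add[OF bij_aut, symmetric])

lemma act_plus1: "x \<in> carrier G \<Longrightarrow> act (k + 1) x = \<alpha> (act k x)"
  unfolding act_def by (rule zpow_map_plus1[OF bij_aut])

lemma act_1 [simp]: "x \<in> carrier G \<Longrightarrow> act 1 x = \<alpha> x"
  using act_plus1[of x 0] by simp

lemma act_mult:
  assumes "x \<in> carrier G" "y \<in> carrier G"
  shows "act k (x \<otimes> y) = act k x \<otimes> act k y"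
  using zpow_map_unique[OF bij_aut, of "\<lambda>k. act k x \<otimes> act k y" k] assms
  by (simp add: act_plus1 aut_mult act_def[symmetric])

lemma act_hom: "act k \<in> hom G G"
  by (simp add: hom_def act_mult)

lemma continuous_act: "continuous_map X X (act k)"
  using continuous_map_zpow_map[of X \<alpha> k] aut by (simp add: topaut_def act_def)

sublocale N: normal N G by (rule normal_N)

sublocale Q: group Q by (rule N.factorgroup_is_group)

lemma symb_hom: "group_hom G Q (symb k)"
proof -
  have "(\<lambda>x. N #> act k x) \<in> hom G Q"
    by (auto simp: hom_def carrier_FactGroup act_mult N.rcos_sum)
  then show ?thesis
    by unfold_locales (simp add: symb_def[abs_def])
qed

lemma symb_closed [simp]: "x \<in> carrier G \<Longrightarrow> symb k x \<in> carrier Q"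
  by (rule group_hom.hom_closed[OF symb_hom])

lemma symb_mult [simp]:
  "x \<in> carrier G \<Longrightarrow> y \<in> carrier G \<Longrightarrow> symb k (x \<otimes> y) = symb k x \<otimes>\<^bsub>Q\<^esub> symb k y"
  by (rule group_hom.hom_mult[OF symb_hom])

lemma symb_inv [simp]: "x \<in> carrier G \<Longrightarrow> symb k (inv x) = inv\<^bsub>Q\<^esub> (symb k x)"
  by (rule group_hom.hom_inv[OF symb_hom])

lemma symb_one [simp]: "symb k \<one> = \<one>\<^bsub>Q\<^esub>"
  by (rule group_hom.hom_one[OF symb_hom])

lemma symb_act [simp]: "x \<in> carrier G \<Longrightarrow> symb k (act j x) = symb (k + j) x"
  by (simp add: symb_def)

declare mult_FactGroup [simp del] one_FactGroup [simp del]

lemma finite_Q: "finite (carrier Q)"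
  using finite_rcosets_open[OF N.subgroup_axioms open_N] by (simp add: FactGroup_def)

lemma symb_eq_iff:
  assumes "x \<in> carrier G" "y \<in> carrier G"
  shows "symb k x = symb k y \<longleftrightarrow> act k (x \<otimes> inv y) \<in> N"
proof -
  have "symb k x = symb k y \<longleftrightarrow> symb k (x \<otimes> inv y) = \<one>\<^bsub>Q\<^esub>"
    using assms by (simp add: Q.right_cancel[of "inv\<^bsub>Q\<^esub> (symb k y)", symmetric] del: Q.right_cancel)
  also have "\<dots> \<longleftrightarrow> act k (x \<otimes> inv y) \<in> N"
    using assms N.rcos_const[OF is_group] rcos_self[OF _ N.subgroup_axioms, of "act k (x \<otimes> inv y)"]
    unfolding symb_def one_FactGroup by auto
  finally show ?thesis .
qed

lemma symb_separates:
  assumes "x \<in> carrier G" "y \<in> carrier G" "\<And>k. symb k x = symb k y"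
  shows "x = y"
proof -
  define z where "z = x \<otimes> inv y"
  have z: "z \<in> carrier G" "\<And>k. act k z \<in> N"
    using assms symb_eq_iff[OF assms(1,2)] by (auto simp: z_def)
  have "z \<in> zpow_map (carrier G) \<alpha> k ` N" for k
  proof -
    have "z = act k (act (- k) z)" using z by simp
    then show ?thesis using z(2) unfolding act_def by blast
  qed
  then have "z = \<one>" using expansive by blast
  then show ?thesis using assms(1,2) inv_equality[of x "inv y"] by (simp add: z_def)
qed

lemma openin_symb_eq: "openin X {y \<in> carrier G. symb k y = c}"
proof (cases "\<exists>x \<in> carrier G. symb k x = c")
  case True
  then obtain x where x: "x \<in> carrier G" "symb k x = c" by blast
  have "{y \<in> carrier G. symb k y = c} = {y \<in> topspace X. act k (y \<otimes> inv x) \<in> N}"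
    using x symb_eq_iff by auto
  moreover have "continuous_map X X (\<lambda>y. act k (y \<otimes> inv x))"
    using continuous_map_compose[OF continuous_mult[of X "\<lambda>y. y" "\<lambda>_. inv x"] continuous_act] x
    by (simp add: o_def)
  ultimately show ?thesis
    using open_N openin_continuous_map_preimage by fastforce
next
  case False
  then have "{y \<in> carrier G. symb k y = c} = {}" by auto
  then show ?thesis by (simp only: openin_empty)
qed

lemma openin_cylinder:
  assumes "finite I"
  shows "openin X {y \<in> carrier G. \<forall>k\<in>I. symb k y = w k}"
  using assms
proof (induction I)
  case (insert i I)
  have "{y \<in> carrier G. \<forall>k\<in>insert i I. symb k y = w k} =
      {y \<in> carrier G. symb i y = w i} \<inter> {y \<in> carrier G. \<forall>k\<in>I. symb k y = w k}" by auto
  then show ?case using insert openin_symb_eq by auto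
qed (use openin_topspace[of X] in simp)

lemma closedin_cylinder: "closedin X {y \<in> carrier G. \<forall>k\<in>I. symb k y = w k}"
proof -
  have "carrier G - {y \<in> carrier G. \<forall>k\<in>I. symb k y = w k} =
      (\<Union>k\<in>I. \<Union>c \<in> -{w k}. {y \<in> carrier G. symb k y = c})" by auto
  moreover have "openin X (\<Union>k\<in>I. \<Union>c \<in> -{w k}. {y \<in> carrier G. symb k y = c})"
    using openin_symb_eq by blast
  ultimately show ?thesis by (simp add: closedin_def)
qed

text \<open>Cantor's intersection theorem. It turns points that satisfy a condition on every finite
  window into one point that satisfies it on an infinite window.\<close>

lemma decseq_closed_nonempty:
  fixes C :: "nat \<Rightarrow> 'a set"
  assumes cl: "\<And>n. closedin X (C n)" and ne: "\<And>n. C n \<noteq> {}" and dec: "\<And>m n. m \<le> n \<Longrightarrow> C n \<subseteq> C m"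
  shows "(\<Inter>n. C n) \<noteq> {}"
proof -
  have "\<Inter>\<F> \<noteq> {}" if "finite \<F>" "\<F> \<subseteq> range C" for \<F>
  proof -
    obtain J where J: "finite J" "\<F> = C ` J"
      using \<open>finite \<F>\<close> \<open>\<F> \<subseteq> range C\<close> by (meson finite_subset_image)
    then have "C (Max (insert 0 J)) \<subseteq> C j" if "j \<in> J" for j
      using that by (intro dec Max_ge) auto
    then have "C (Max (insert 0 J)) \<subseteq> \<Inter>\<F>" using J(2) by auto
    then show ?thesis using ne by fast
  qed
  then show ?thesis
    using compact[unfolded compact_space_fip, rule_format, of "range C"] cl by auto
qed

text \<open>Otherwise compactness would give a point outside \<open>U\<close> with the same word as
  \<open>x\<close>, hence equal to \<open>x\<close>. Together with \<open>openin_cylinder\<close>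
  this identifies the topology of \<open>X\<close> with that of the words.\<close>

lemma cylinder_base:
  assumes "openin X U" "x \<in> U"
  shows "\<exists>m::nat. \<forall>y\<in>carrier G. (\<forall>k\<in>{-int m..int m}. symb k y = symb k x) \<longrightarrow> y \<in> U"
proof (rule ccontr)
  assume neg: "\<not> ?thesis"
  have x: "x \<in> carrier G" using assms openin_subset by fastforce
  define C where "C m = {y \<in> carrier G. \<forall>k\<in>{-int m..int m}. symb k y = symb k x} - U" for m
  have "(\<Inter>m. C m) \<noteq> {}"
  proof (rule decseq_closed_nonempty)
    show "closedin X (C m)" for m
      unfolding C_def by (intro closedin_diff closedin_cylinder assms)
    show "C m \<noteq> {}" for m using neg by (auto simp: C_def)
    show "C n \<subseteq> C m" if "m \<le> n" for m n using that by (auto simp: C_def)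
  qed
  then obtain y where y: "\<And>m. y \<in> C m" by blast
  then have "symb k y = symb k x" for k
  proof -
    have "k \<in> {- int (nat \<bar>k\<bar>)..int (nat \<bar>k\<bar>)}" by auto
    then show ?thesis using y[of "nat \<bar>k\<bar>"] unfolding C_def by blast
  qed
  then have "y = x" using x y[of 0] by (intro symb_separates) (auto simp: C_def)
  then show False using y[of 0] assms by (simp add: C_def)
qed

lemma closure_of_eq_cylinders:
  assumes "A \<subseteq> carrier G"
  shows "X closure_of A =
    {x \<in> carrier G. \<forall>m::nat. \<exists>c\<in>A. \<forall>k\<in>{-int m..int m}. symb k c = symb k x}"
proof (intro equalityI subsetI CollectI conjI allI)
  fix x assume "x \<in> X closure_of A"
  then have x: "x \<in> carrier G" and cl: "\<And>T. x \<in> T \<Longrightarrow> openin X T \<Longrightarrow> \<exists>y\<in>A. y \<in> T"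
    by (auto simp: in_closure_of)
  show "x \<in> carrier G" by fact
  show "\<exists>c\<in>A. \<forall>k\<in>{-int m..int m}. symb k c = symb k x" for m
    using cl[OF _ openin_cylinder[of "{-int m..int m}" "\<lambda>k. symb k x"]] x by auto
next
  fix x assume x: "x \<in> {x \<in> carrier G. \<forall>m::nat. \<exists>c\<in>A. \<forall>k\<in>{-int m..int m}. symb k c = symb k x}"
  show "x \<in> X closure_of A"
    unfolding in_closure_of
  proof (intro conjI allI impI)
    show "x \<in> topspace X" using x by simp
    fix U assume U: "x \<in> U \<and> openin X U"
    then obtain m where m: "\<forall>y\<in>carrier G. (\<forall>k\<in>{-int m..int m}. symb k y = symb k x) \<longrightarrow> y \<in> U"
      using cylinder_base by blast
    obtain c where "c \<in> A" "\<forall>k\<in>{-int m..int m}. symb k c = symb k x" using x by blast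
    then show "\<exists>y. y \<in> A \<and> y \<in> U" using m assms by blast
  qed
qed

lemma finite_patterns:
  assumes "finite I" "K \<subseteq> carrier G"
  shows "finite ((\<lambda>x. restrict (\<lambda>k. symb k x) I) ` K)"
proof (rule finite_subset)
  show "(\<lambda>x. restrict (\<lambda>k. symb k x) I) ` K \<subseteq> (\<Pi>\<^sub>E k\<in>I. carrier Q)"
    using assms(2) by (auto simp: PiE_def)
  show "finite (\<Pi>\<^sub>E k\<in>I. carrier Q)" using assms(1) finite_Q by (simp add: finite_PiE)
qed

lemma pattern_pigeonhole:
  fixes f :: "nat \<Rightarrow> 'a"
  assumes I: "finite I" and f: "\<And>n. f n \<in> carrier G"
  shows "\<exists>i j. i < j \<and> (\<forall>k\<in>I. symb k (f i) = symb k (f j))"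
proof -
  let ?p = "\<lambda>n. restrict (\<lambda>k. symb k (f n)) I"
  have "finite (range ?p)"
    using finite_patterns[OF I, of "range f"] f by (simp add: image_image image_subset_iff)
  then have "\<not> inj ?p" using finite_imageD infinite_UNIV_nat by blast
  then obtain i j where ij: "i < j" "?p i = ?p j"
    unfolding inj_on_def by (metis nat_neq_iff)
  then have "symb k (f i) = symb k (f j)" if "k \<in> I" for k
    using that by (metis restrict_apply')
  then show ?thesis using ij(1) by blast
qed

subsection \<open>The nub of a stable subgroup\<close>

definition stable :: "'a set \<Rightarrow> bool" where
  "stable K \<longleftrightarrow> subgroup K G \<and> closedin X K \<and> \<alpha> ` K = K"

text \<open>Because \<open>\<alpha>\<close> is expansive and \<open>G\<close> is compact, these are the elements of \<open>K\<close> whose forward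
  orbit converges to the identity.\<close>

definition con :: "'a set \<Rightarrow> 'a set" where
  "con K = {x \<in> K. \<exists>M. \<forall>k\<ge>M. symb k x = \<one>\<^bsub>Q\<^esub>}"

text \<open>For stable \<open>K\<close> this is the largest closed stable subgroup of
  \<open>K\<close> on which \<alpha> is topologically transitive: any such \<open>L\<close> equals
  \<open>nub L\<close>, which lies in \<open>nub K\<close>.\<close>

definition nub :: "'a set \<Rightarrow> 'a set" where
  "nub K = X closure_of con K"

lemma stableD:
  assumes "stable K"
  shows "subgroup K G" "closedin X K" "\<alpha> ` K = K" "K \<subseteq> carrier G"
    "\<one> \<in> K" "x \<in> K \<Longrightarrow> x \<in> carrier G" "x \<in> K \<Longrightarrow> inv x \<in> K"
    "x \<in> K \<Longrightarrow> y \<in> K \<Longrightarrow> x \<otimes> y \<in> K"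
  using assms unfolding stable_def
  by (auto simp: subgroup.subset subgroup.mem_carrier subgroup.one_closed subgroup.m_inv_closed
      subgroup.m_closed)

lemma stable_bij:
  assumes "stable K"
  shows "bij_betw \<alpha> K K"
  using bij_betw_subset[OF bij_aut stableD(4)[OF assms]] stableD(3)[OF assms] by simp

lemma act_eq_zpow_map:
  assumes K: "stable K" and x: "x \<in> K"
  shows "act k x = zpow_map K \<alpha> k x"
  using zpow_map_semiconj[OF stable_bij[OF K] bij_aut, of "\<lambda>x. x"] stableD(6)[OF K] x
  by (simp add: act_def)

lemma stable_act:
  assumes K: "stable K" and x: "x \<in> K"
  shows "act k x \<in> K"
  using zpow_map_in[OF stable_bij[OF K] x] act_eq_zpow_map[OF K x] by simp

section \<open>The finite type property of stable subgroups\<close>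

text \<open>The set \<open>A n\<close> of symbols that can follow \<open>n\<close> trivial ones is
  finite and decreases with \<open>n\<close>, so it is constant beyond an index \<open>n0\<close> of
  least cardinality. A run of \<open>n0\<close> trivial symbols therefore permits no next symbol
  that a longer run would exclude.\<close>

lemma window_stabilises:
  assumes K: "stable K"
  shows "\<exists>n0::nat. \<forall>n::nat. \<forall>x\<in>K. (\<forall>k\<in>{-int n0..-1}. symb k x = \<one>\<^bsub>Q\<^esub>) \<longrightarrow>
    (\<exists>y\<in>K. (\<forall>k\<in>{-int n..-1}. symb k y = \<one>\<^bsub>Q\<^esub>) \<and> symb 0 y = symb 0 x)"
proof -
  define A where "A n = symb 0 ` {x \<in> K. \<forall>k\<in>{-int n..-1}. symb k x = \<one>\<^bsub>Q\<^esub>}" for n :: nat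
  have fin: "finite (A n)" for n
  proof (rule finite_subset[OF _ finite_Q])
    show "A n \<subseteq> carrier Q" using stableD(6)[OF K] by (auto simp: A_def)
  qed
  have dec: "A n \<subseteq> A m" if "m \<le> n" for m n
    using that unfolding A_def by (intro image_mono) auto
  obtain n0 where n0: "\<And>n. card (A n0) \<le> card (A n)"
    using ex_has_least_nat[of "\<lambda>_. True" 0 "\<lambda>n. card (A n)"] by blast
  have "A n0 \<subseteq> A n" for n
  proof -
    have "A (max n n0) = A n0"
      using dec[of n0 "max n n0"] n0[of "max n n0"] fin by (intro card_seteq) auto
    then show ?thesis using dec[of n "max n n0"] by simp
  qed
  note sub = this
  show ?thesis
  proof (intro exI[of _ n0] allI ballI impI)
    fix n x assume "x \<in> K" "\<forall>k\<in>{-int n0..-1}. symb k x = \<one>\<^bsub>Q\<^esub>"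
    then have "symb 0 x \<in> A n" using sub[of n] by (auto simp: A_def)
    then show "\<exists>y\<in>K. (\<forall>k\<in>{-int n..-1}. symb k y = \<one>\<^bsub>Q\<^esub>) \<and> symb 0 y = symb 0 x"
      by (force simp: A_def)
  qed
qed

text \<open>The subshift of finite type property: a window of length \<open>n\<^sub>0\<close> separates past and future.\<close>

lemma window_splits:
  assumes K: "stable K"
  shows "\<exists>n0::nat. \<forall>x\<in>K. (\<forall>k\<in>{-int n0..-1}. symb k x = \<one>\<^bsub>Q\<^esub>) \<longrightarrow>
    (\<exists>c\<in>K. (\<forall>k\<ge>-int n0. symb k c = \<one>\<^bsub>Q\<^esub>) \<and> (\<forall>k\<le>-1. symb k c = symb k x))"
proof -
  obtain n0 :: nat where n0: "\<And>n::nat. \<And>x. x \<in> K \<Longrightarrow> (\<forall>k\<in>{-int n0..-1}. symb k x = \<one>\<^bsub>Q\<^esub>) \<Longrightarrow>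
    (\<exists>y\<in>K. (\<forall>k\<in>{-int n..-1}. symb k y = \<one>\<^bsub>Q\<^esub>) \<and> symb 0 y = symb 0 x)"
    using window_stabilises[OF K] by blast
  have step: "\<exists>c\<in>K. (\<forall>k\<in>{-int n0..int p - 1}. symb k c = \<one>\<^bsub>Q\<^esub>) \<and>
      (\<forall>k\<in>{-int n..-1}. symb k c = symb k x)"
    if x: "x \<in> K" "\<forall>k\<in>{-int n0..-1}. symb k x = \<one>\<^bsub>Q\<^esub>" for x and n p :: nat
  proof (induction p)
    case 0
    then show ?case using x by auto
  next
    case (Suc p)
    then obtain c where c: "c \<in> K" "\<And>k. k \<in> {-int n0..int p - 1} \<Longrightarrow> symb k c = \<one>\<^bsub>Q\<^esub>"
      "\<And>k. k \<in> {-int n..-1} \<Longrightarrow> symb k c = symb k x" by blast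
    have cG: "c \<in> carrier G" using c(1) stableD(6)[OF K] by blast
    have "\<forall>k\<in>{-int n0..-1}. symb k (act (int p) c) = \<one>\<^bsub>Q\<^esub>" using c(2) cG by auto
    \<comment> \<open>The symbol at position \<open>p\<close> is to be cancelled. Shifted by
      \<open>p\<close>, the trivial stretch of \<open>y\<close> covers \<open>-(n + n0)\<close> up
      to \<open>p - 1\<close>, which contains both windows that must stay unchanged.\<close>
    then obtain y where y: "y \<in> K" "\<And>k. k \<in> {-int (n + n0 + p)..-1} \<Longrightarrow> symb k y = \<one>\<^bsub>Q\<^esub>"
      "symb 0 y = symb 0 (act (int p) c)"
      using n0[OF stable_act[OF K c(1)], of "int p" "n + n0 + p"] by blast
    have yG: "y \<in> carrier G" using y(1) stableD(6)[OF K] by blast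
    define c' where "c' = inv (act (-int p) y) \<otimes> c"
    have c': "symb k c' = inv\<^bsub>Q\<^esub> (symb (k - int p) y) \<otimes>\<^bsub>Q\<^esub> symb k c" for k
      using yG cG by (simp add: c'_def)
    have old: "symb k c' = symb k c" if "k \<in> {-int (n + n0)..int p - 1}" for k
      using that y(2)[of "k - int p"] cG by (simp add: c')
    have new: "symb (int p) c' = \<one>\<^bsub>Q\<^esub>" using y(3) cG yG by (simp add: c')
    show ?case
    proof (intro bexI[of _ c'] conjI ballI)
      show "c' \<in> K" unfolding c'_def using K c(1) y(1) by (simp add: stableD stable_act)
      show "symb k c' = \<one>\<^bsub>Q\<^esub>" if "k \<in> {- int n0..int (Suc p) - 1}" for k
        using that old[of k] c(2)[of k] new by (cases "k = int p") auto
      show "symb k c' = symb k x" if "k \<in> {- int n..- 1}" for k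
        using that old[of k] c(3)[of k] by auto
    qed
  qed
  show ?thesis
  proof (intro exI[of _ n0] ballI impI)
    fix x assume x: "x \<in> K" "\<forall>k\<in>{-int n0..-1}. symb k x = \<one>\<^bsub>Q\<^esub>"
    \<comment> \<open>Both windows grow with \<open>p\<close>, and \<open>step\<close> taken with
      \<open>n = p\<close> shows each \<open>C p\<close> to be nonempty; a common point is trivial
      from \<open>-n0\<close> on and has the past of \<open>x\<close>.\<close>
    define C where "C p = K \<inter> ({y \<in> carrier G. \<forall>k\<in>{-int n0..int p - 1}. symb k y = \<one>\<^bsub>Q\<^esub>} \<inter>
      {y \<in> carrier G. \<forall>k\<in>{-int p..-1}. symb k y = symb k x})" for p :: nat
    have "(\<Inter>p. C p) \<noteq> {}"
    proof (rule decseq_closed_nonempty)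
      show "closedin X (C p)" for p
        unfolding C_def by (intro closedin_Int closedin_cylinder stableD(2)[OF K])
      show "C p \<noteq> {}" for p
        using step[OF x, of p p] stableD(6)[OF K] by (force simp: C_def)
      show "C n \<subseteq> C m" if "m \<le> n" for m n
        using that by (auto simp: C_def)
    qed
    then obtain c where c: "\<And>p. c \<in> C p" by blast
    show "\<exists>c\<in>K. (\<forall>k\<ge>-int n0. symb k c = \<one>\<^bsub>Q\<^esub>) \<and> (\<forall>k\<le>-1. symb k c = symb k x)"
    proof (intro bexI[of _ c] conjI allI impI)
      show "c \<in> K" using c[of 0] by (simp add: C_def)
      show "symb k c = \<one>\<^bsub>Q\<^esub>" if "- int n0 \<le> k" for k
      proof -
        have "k \<in> {-int n0..int (nat (k + 1)) - 1}" using that by auto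
        then show ?thesis using c[of "nat (k + 1)"] unfolding C_def by blast
      qed
      show "symb k c = symb k x" if "k \<le> -1" for k
      proof -
        have "k \<in> {-int (nat (-k))..-1}" using that by auto
        then show ?thesis using c[of "nat (-k)"] unfolding C_def by blast
      qed
    qed
  qed
qed

section \<open>The nub as a closed stable subgroup\<close>

lemma con_subset: "con K \<subseteq> K"
  by (auto simp: con_def)

lemma con_mono: "K \<subseteq> L \<Longrightarrow> con K \<subseteq> con L"
  by (auto simp: con_def)

lemma nub_iff:
  assumes "K \<subseteq> carrier G"
  shows "x \<in> nub K \<longleftrightarrow> x \<in> carrier G \<and> (\<forall>m::nat. \<exists>c\<in>con K. \<forall>k\<in>{-int m..int m}. symb k c = symb k x)"
  unfolding nub_def using closure_of_eq_cylinders[of "con K"] assms con_subset[of K] by auto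

lemma nub_mono: "K \<subseteq> L \<Longrightarrow> nub K \<subseteq> nub L"
  unfolding nub_def by (intro closure_of_mono con_mono)

lemma con_subset_nub: "K \<subseteq> carrier G \<Longrightarrow> con K \<subseteq> nub K"
  unfolding nub_def using con_subset[of K] by (intro closure_of_subset) auto

lemma nub_subset: "stable K \<Longrightarrow> nub K \<subseteq> K"
  unfolding nub_def using con_subset stableD(2) closure_of_minimal by metis

lemma con_mult:
  assumes K: "K \<subseteq> carrier G" and L: "L \<subseteq> carrier G" and x: "x \<in> con K" and y: "y \<in> con L"
  shows "x \<otimes> y \<in> con (K <#> L)"
proof -
  obtain M M' where M: "\<And>k. k \<ge> M \<Longrightarrow> symb k x = \<one>\<^bsub>Q\<^esub>" "\<And>k. k \<ge> M' \<Longrightarrow> symb k y = \<one>\<^bsub>Q\<^esub>"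
    using x y by (auto simp: con_def)
  have xy: "x \<in> K" "y \<in> L" using x y by (auto simp: con_def)
  then have "symb k (x \<otimes> y) = \<one>\<^bsub>Q\<^esub>" if "k \<ge> max M M'" for k
    using that M K L by (simp add: subset_iff)
  then show ?thesis using xy unfolding con_def set_mult_def by blast
qed

text \<open>Approximations on a window multiply symbol by symbol. The case \<open>K = L\<close>
  yields closure of the nub under products; the general case yields transitivity of products of
  transitive subgroups.\<close>

lemma nub_mult:
  assumes K: "K \<subseteq> carrier G" and L: "L \<subseteq> carrier G" and x: "x \<in> nub K" and y: "y \<in> nub L"
  shows "x \<otimes> y \<in> nub (K <#> L)"
proof -
  have KL: "K <#> L \<subseteq> carrier G" using K L by (auto simp: set_mult_def)
  have G: "x \<in> carrier G" "y \<in> carrier G" using x y nub_iff K L by auto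
  have "\<exists>c\<in>con (K <#> L). \<forall>k\<in>{-int m..int m}. symb k c = symb k (x \<otimes> y)" for m
  proof -
    obtain c where c: "c \<in> con K" "\<forall>k\<in>{-int m..int m}. symb k c = symb k x"
      using x nub_iff[OF K] by blast
    obtain d where d: "d \<in> con L" "\<forall>k\<in>{-int m..int m}. symb k d = symb k y"
      using y nub_iff[OF L] by blast
    have "c \<in> carrier G" "d \<in> carrier G" using c d con_subset K L by blast+
    then show ?thesis
      using con_mult[OF K L c(1) d(1)] c(2) d(2) G by (intro bexI[of _ "c \<otimes> d"]) auto
  qed
  then show ?thesis using G nub_iff[OF KL] by simp
qed

lemma nub_stable:
  assumes K: "stable K"
  shows "stable (nub K)"
proof -
  note KG = stableD(4)[OF K]
  have KK: "K <#> K = K" by (rule subgroup_mult_id[OF stableD(1)[OF K]])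
  have cinv: "inv x \<in> con K" if "x \<in> con K" for x
    using that stableD(6,7)[OF K] by (fastforce simp: con_def)
  have cact: "act j x \<in> con K" if "x \<in> con K" for x j
  proof -
    from that obtain M where M: "\<And>k. k \<ge> M \<Longrightarrow> symb k x = \<one>\<^bsub>Q\<^esub>" and x: "x \<in> K"
      by (auto simp: con_def)
    then have "symb k (act j x) = \<one>\<^bsub>Q\<^esub>" if "k \<ge> M - j" for k
      using that stableD(6)[OF K x] by simp
    then show ?thesis using stable_act[OF K x] unfolding con_def by blast
  qed
  have sub: "subgroup (nub K) G"
  proof (rule subgroupI)
    show "nub K \<subseteq> carrier G" using nub_subset[OF K] KG by simp
    have "\<one> \<in> con K" using stableD(5)[OF K] by (simp add: con_def)
    then show "nub K \<noteq> {}" using con_subset_nub[OF KG] by blast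
    show "x \<otimes> y \<in> nub K" if "x \<in> nub K" "y \<in> nub K" for x y
      using nub_mult[OF KG KG that] KK by simp
    show "inv x \<in> nub K" if x: "x \<in> nub K" for x
    proof -
      have xG: "x \<in> carrier G" using x nub_iff[OF KG] by simp
      have "\<exists>c\<in>con K. \<forall>k\<in>{-int m..int m}. symb k c = symb k (inv x)" for m
      proof -
        obtain c where "c \<in> con K" "\<forall>k\<in>{-int m..int m}. symb k c = symb k x"
          using x nub_iff[OF KG] by blast
        then show ?thesis
          using xG cinv con_subset[of K] KG by (intro bexI[of _ "inv c"]) auto
      qed
      then show ?thesis using xG nub_iff[OF KG] by simp
    qed
  qed
  have actn: "act j x \<in> nub K" if x: "x \<in> nub K" for x j
  proof -
    have "act j ` (X closure_of con K) \<subseteq> X closure_of (act j ` con K)"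
      using continuous_act by (rule continuous_map_image_closure_subset)
    also have "\<dots> \<subseteq> X closure_of con K"
      using cact by (intro closure_of_mono) auto
    finally show ?thesis using x by (auto simp: nub_def)
  qed
  have "x \<in> \<alpha> ` nub K" if "x \<in> nub K" for x
  proof -
    have "x \<in> carrier G" using that subgroup.mem_carrier[OF sub] by blast
    then have "x = \<alpha> (act (-1) x)" using act_plus1[of x "-1"] by simp
    then show ?thesis using actn[OF that] by blast
  qed
  moreover have "\<alpha> x \<in> nub K" if "x \<in> nub K" for x
    using actn[OF that, of 1] subgroup.mem_carrier[OF sub that] by simp
  ultimately have "\<alpha> ` nub K = nub K" by blast
  then show ?thesis using sub by (simp add: stable_def nub_def)
qed

text \<open>Contraction is a property of the element alone and \<open>con K\<close> already lies in
  \<open>nub K\<close>, so \<open>K\<close> and \<open>nub K\<close> have the same contracting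
  elements.\<close>

lemma nub_nub:
  assumes "stable K"
  shows "nub (nub K) = nub K"
proof -
  have "con (nub K) = con K"
    using con_subset_nub[OF stableD(4)[OF assms]] nub_subset[OF assms] by (auto simp: con_def)
  then show ?thesis by (simp add: nub_def)
qed

text \<open>Since \<open>N\<close> is normal in \<open>G\<close>, conjugation by an element that normalises \<open>K\<close> preserves the
  contraction group of \<open>K\<close>, although it need not commute with \<open>\<alpha>\<close>.\<close>

lemma nub_conj:
  assumes K: "K \<subseteq> carrier G" and g: "g \<in> carrier G" and norm: "\<And>x. x \<in> K \<Longrightarrow> g \<otimes> x \<otimes> inv g \<in> K"
    and x: "x \<in> nub K"
  shows "g \<otimes> x \<otimes> inv g \<in> nub K"
proof -
  have xG: "x \<in> carrier G" using x nub_iff[OF K] by simp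
  have "\<exists>c\<in>con K. \<forall>k\<in>{-int m..int m}. symb k c = symb k (g \<otimes> x \<otimes> inv g)" for m
  proof -
    obtain c where c: "c \<in> con K" "\<forall>k\<in>{-int m..int m}. symb k c = symb k x"
      using x nub_iff[OF K] by blast
    then obtain M where M: "\<And>k. k \<ge> M \<Longrightarrow> symb k c = \<one>\<^bsub>Q\<^esub>" and cK: "c \<in> K"
      by (auto simp: con_def)
    have cG: "c \<in> carrier G" using cK K by blast
    have "symb k (g \<otimes> c \<otimes> inv g) = \<one>\<^bsub>Q\<^esub>" if "k \<ge> M" for k
      using M[OF that] cG g by simp
    then have "g \<otimes> c \<otimes> inv g \<in> con K" using norm[OF cK] unfolding con_def by blast
    then show ?thesis using c(2) cG xG g by (intro bexI[of _ "g \<otimes> c \<otimes> inv g"]) auto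
  qed
  then show ?thesis using xG g nub_iff[OF K] by simp
qed

section \<open>Openness and finite index of the nub\<close>

text \<open>The window of \<open>window_splits\<close> works. An \<open>x\<close> trivial on it has
  the same past as some contracting \<open>c\<close>, and \<open>x \<otimes> inv c\<close> has
  trivial past; so it is enough to approximate elements with trivial past by contracting ones, which
  is \<open>past\<close>.\<close>

lemma nub_contains_window:
  assumes K: "stable K"
  shows "\<exists>n0::nat. \<forall>x\<in>K. (\<forall>k\<in>{-int n0..-1}. symb k x = \<one>\<^bsub>Q\<^esub>) \<longrightarrow> x \<in> nub K"
proof -
  note KG = stableD(4)[OF K]
  obtain n0 :: nat where split: "\<And>x. x \<in> K \<Longrightarrow> (\<forall>k\<in>{-int n0..-1}. symb k x = \<one>\<^bsub>Q\<^esub>) \<Longrightarrow>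
    (\<exists>c\<in>K. (\<forall>k\<ge>-int n0. symb k c = \<one>\<^bsub>Q\<^esub>) \<and> (\<forall>k\<le>-1. symb k c = symb k x))"
    using window_splits[OF K] by blast
  have past: "y \<in> nub K" if y: "y \<in> K" "\<forall>k\<le>-1. symb k y = \<one>\<^bsub>Q\<^esub>" for y
  proof -
    have yG: "y \<in> carrier G" using y(1) KG by blast
    have "\<exists>c\<in>con K. \<forall>k\<in>{-int m..int m}. symb k c = symb k y" for m
    proof -
      \<comment> \<open>Spacing the sampled times by more than \<open>m\<close> puts the window from
        \<open>-m\<close> to \<open>m\<close> entirely below both \<open>d\<close> and
        \<open>e\<close>.\<close>
      define L where "L = int m + 1"
      obtain i j :: nat where ij: "i < j"
        "\<And>k. k \<in> {-int n0..-1} \<Longrightarrow> symb k (act ((int i + 1) * L) y) = symb k (act ((int j + 1) * L) y)"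
        using pattern_pigeonhole[of "{-int n0..-1}" "\<lambda>i. act ((int i + 1) * L) y"] yG by auto
      define e d where "e = (int j + 1) * L" and "d = (int j - int i) * L"
      have L0: "L \<ge> 1" by (simp add: L_def)
      have d: "d \<ge> L" using ij(1) mult_right_mono[of 1 "int j - int i" L] L0 by (simp add: d_def)
      have e: "e \<ge> L" using mult_right_mono[of 1 "int j + 1" L] L0 by (simp add: e_def)
      have ed: "e - d = (int i + 1) * L" by (simp add: e_def d_def algebra_simps)
      \<comment> \<open>The symbol of \<open>y'\<close> at \<open>k\<close> is that of
        \<open>y\<close> at \<open>k\<close> divided by that of \<open>y\<close> at
        \<open>k - d\<close>. Below \<open>d\<close> the divisor is trivial, because
        \<open>y\<close> has trivial past; on the \<open>n0\<close> positions before
        \<open>e\<close> the two cancel by the choice of \<open>i\<close> and \<open>j\<close>.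
        Hence \<open>y'\<close> can be cut off at \<open>e\<close> without change below
        \<open>e\<close>.\<close>
      define y' where "y' = y \<otimes> inv (act (- d) y)"
      have y': "y' \<in> K" using y(1) K by (simp add: y'_def stableD stable_act)
      then have y'G: "y' \<in> carrier G" using KG by blast
      have sy': "symb k y' = symb k y \<otimes>\<^bsub>Q\<^esub> inv\<^bsub>Q\<^esub> symb (k - d) y" for k
        using yG by (simp add: y'_def)
      have agree: "symb k y' = symb k y" if "k < d" for k
        using that y(2)[rule_format, of "k - d"] yG by (simp add: sy')
      have "symb k (act e y') = \<one>\<^bsub>Q\<^esub>" if "k \<in> {-int n0..-1}" for k
      proof -
        have "symb (k + e - d) y = symb (k + e) y"
          using ij(2)[OF that] yG ed by (simp add: e_def add_diff_eq[symmetric])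
        then show ?thesis using y'G yG by (simp add: sy')
      qed
      then obtain c where c: "c \<in> K" "\<And>k. k \<ge> -int n0 \<Longrightarrow> symb k c = \<one>\<^bsub>Q\<^esub>"
        "\<And>k. k \<le> -1 \<Longrightarrow> symb k c = symb k (act e y')"
        using split[OF stable_act[OF K y']] by blast
      have cG: "c \<in> carrier G" using c(1) KG by blast
      have "\<forall>k\<ge>e. symb k (act (-e) c) = \<one>\<^bsub>Q\<^esub>"
        using c(2) cG by simp
      then have "act (-e) c \<in> con K"
        using stable_act[OF K c(1)] unfolding con_def by blast
      moreover have "symb k (act (-e) c) = symb k y" if "k \<in> {-int m..int m}" for k
        using that c(3)[of "k - e"] e d cG y'G agree[of k] by (simp add: L_def)
      ultimately show ?thesis by blast
    qed
    then show ?thesis using yG nub_iff[OF KG] by simp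
  qed
  have "x \<in> nub K" if x: "x \<in> K" "\<forall>k\<in>{-int n0..-1}. symb k x = \<one>\<^bsub>Q\<^esub>" for x
  proof -
    obtain c where c: "c \<in> K" "\<forall>k\<ge>-int n0. symb k c = \<one>\<^bsub>Q\<^esub>" "\<forall>k\<le>-1. symb k c = symb k x"
      using split[OF x] by blast
    have G: "x \<in> carrier G" "c \<in> carrier G" using x(1) c(1) KG by blast+
    have "x \<otimes> inv c \<in> nub K"
      using x(1) c G K by (intro past) (simp_all add: stableD)
    moreover have "c \<in> nub K"
      using c con_subset_nub[OF KG] unfolding con_def by blast
    ultimately have "x \<otimes> inv c \<otimes> c \<in> nub K"
      using stableD(8)[OF nub_stable[OF K]] by blast
    then show ?thesis using G by (simp add: m_assoc)
  qed
  then show ?thesis by blast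
qed

text \<open>Elements with the same symbols on the window of \<open>nub_contains_window\<close>
  differ by an element of \<open>nub K\<close>, and a finite window carries finitely many
  patterns.\<close>

lemma nub_finite_index:
  assumes K: "stable K"
  shows "\<exists>F. finite F \<and> F \<subseteq> K \<and> K = F <#> nub K"
proof -
  note KG = stableD(4)[OF K]
  obtain n0 :: nat where n0: "\<And>x. x \<in> K \<Longrightarrow> (\<forall>k\<in>{-int n0..-1}. symb k x = \<one>\<^bsub>Q\<^esub>) \<Longrightarrow> x \<in> nub K"
    using nub_contains_window[OF K] by blast
  let ?p = "\<lambda>x. restrict (\<lambda>k. symb k x) {-int n0..-1}"
  obtain F where F: "F \<subseteq> K" "finite F" "?p ` K = ?p ` F"
    using finite_subset_image[OF finite_patterns[OF _ KG], of "{-int n0..-1}" ?p K] by auto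
  have "x \<in> F <#> nub K" if x: "x \<in> K" for x
  proof -
    obtain f where f: "f \<in> F" "?p x = ?p f" using F(3) x by (metis (no_types, lifting) imageE imageI)
    have G: "x \<in> carrier G" "f \<in> carrier G" "f \<in> K" using x f(1) F(1) KG by auto
    have "symb k x = symb k f" if "k \<in> {-int n0..-1}" for k
      using fun_cong[OF f(2), of k] that by simp
    then have "inv f \<otimes> x \<in> nub K"
      using G x K by (intro n0) (simp_all add: stableD)
    moreover have "x = f \<otimes> (inv f \<otimes> x)" using G by (simp add: inv_mult_cancel)
    ultimately show ?thesis using f(1) unfolding set_mult_def by blast
  qed
  moreover have "F <#> nub K \<subseteq> K"
    using F(1) nub_subset[OF K] stableD(8)[OF K] by (auto simp: set_mult_def)
  ultimately show ?thesis using F(1,2) by blast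
qed

section \<open>Transitivity in terms of the nub\<close>

lemma orbit_eq:
  assumes K: "stable K" and x: "x \<in> K"
  shows "{zpow_map (topspace (subtopology X K)) \<alpha> k x | k. True} = range (\<lambda>k. act k x)"
proof -
  have "topspace (subtopology X K) = K" using stableD(4)[OF K] by auto
  then show ?thesis using act_eq_zpow_map[OF K x] by auto
qed

text \<open>The nub contains a neighbourhood of the identity in \<open>K\<close>, so a dense orbit
  enters it; being stable and closed, the nub then contains the orbit and its closure.\<close>

lemma transitive_imp_nub:
  assumes K: "stable K" and tt: "top_transitive (subtopology X K) \<alpha>"
  shows "nub K = K"
proof -
  note KG = stableD(4)[OF K]
  have top: "topspace (subtopology X K) = K" using KG by auto
  obtain x where x: "x \<in> K" and dense: "subtopology X K closure_of (range (\<lambda>k. act k x)) = K"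
    using tt orbit_eq[OF K] unfolding top_transitive_def top by auto
  obtain n0 :: nat where n0: "\<And>x. x \<in> K \<Longrightarrow> (\<forall>k\<in>{-int n0..-1}. symb k x = \<one>\<^bsub>Q\<^esub>) \<Longrightarrow> x \<in> nub K"
    using nub_contains_window[OF K] by blast
  let ?U = "{y \<in> carrier G. \<forall>k\<in>{-int n0..-1}. symb k y = \<one>\<^bsub>Q\<^esub>}"
  have "openin (subtopology X K) (?U \<inter> K)"
    by (intro openin_subtopology_Int openin_cylinder) simp
  moreover have "\<one> \<in> ?U \<inter> K" "\<one> \<in> subtopology X K closure_of (range (\<lambda>k. act k x))"
    using stableD(5)[OF K] dense by auto
  ultimately have "\<exists>y. y \<in> range (\<lambda>k. act k x) \<and> y \<in> ?U \<inter> K"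
    unfolding in_closure_of by (metis (no_types, lifting))
  then obtain n where "act n x \<in> ?U \<inter> K" by blast
  then have n: "act n x \<in> nub K" using n0 by blast
  have "act k x \<in> nub K" for k
    using stable_act[OF nub_stable[OF K] n, of "k - n"] x KG by auto
  then have "range (\<lambda>k. act k x) \<subseteq> nub K" by blast
  moreover have "closedin (subtopology X K) (nub K)"
    using nub_subset[OF K] stableD(2)[OF nub_stable[OF K]] by (simp add: closedin_subset_topspace)
  ultimately have "K \<subseteq> nub K" using dense closure_of_minimal by metis
  then show ?thesis using nub_subset[OF K] by blast
qed

text \<open>Moving \<open>x\<close> close to \<open>y\<close>: contracting elements \<open>c, d\<close> close to \<open>x, y\<close> are combined into
  \<open>c \<otimes> act (-n) (d \<otimes> act (n - l) (inv d))\<close>, where \<open>n - l\<close> is a return time of the backward orbit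
  of \<open>d\<close>.\<close>

lemma nub_mixing:
  assumes K: "stable K" "nub K = K" and x: "x \<in> K" and y: "y \<in> K"
  shows "\<exists>z\<in>K. \<exists>n. (\<forall>k\<in>{-int m..int m}. symb k z = symb k x) \<and>
    (\<forall>k\<in>{-int m..int m}. symb k (act n z) = symb k y)"
proof -
  note KG = stableD(4)[OF K(1)]
  have "x \<in> nub K" "y \<in> nub K" using x y K(2) by auto
  then obtain c d where cd: "c \<in> con K" "d \<in> con K"
    "\<And>k. k \<in> {-int m..int m} \<Longrightarrow> symb k c = symb k x"
    "\<And>k. k \<in> {-int m..int m} \<Longrightarrow> symb k d = symb k y"
    using nub_iff[OF KG] by meson
  then obtain M M' where M: "\<And>k. k \<ge> M \<Longrightarrow> symb k c = \<one>\<^bsub>Q\<^esub>" "\<And>k. k \<ge> M' \<Longrightarrow> symb k d = \<one>\<^bsub>Q\<^esub>"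
    and cdK: "c \<in> K" "d \<in> K"
    unfolding con_def by blast
  have G: "c \<in> carrier G" "d \<in> carrier G" "x \<in> carrier G" using cdK KG x by auto
  \<comment> \<open>At the positions \<open>k + n\<close>, with \<open>k\<close> in the window,
    \<open>c\<close> has become trivial and so has the copy of \<open>d\<close> delayed by
    \<open>l\<close>, since \<open>n\<close> and \<open>n - l\<close> are at least \<open>L\<close>.
    The bound 1 makes the sampled times strictly increasing.\<close>
  define L where "L = max 1 (max M M' + int m)"
  obtain i j :: nat where ij: "i < j" "\<And>k. k \<in> {-int m..int m} \<Longrightarrow>
      symb k (act (- ((int i + 1) * L)) d) = symb k (act (- ((int j + 1) * L)) d)"
    using pattern_pigeonhole[of "{-int m..int m}" "\<lambda>i. act (- ((int i + 1) * L)) d"] G by auto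
  define n l where "n = (int j + 1) * L" and "l = (int i + 1) * L"
  have L0: "L \<ge> 1" by (simp add: L_def)
  have nl: "n - l \<ge> L"
    using ij(1) mult_right_mono[of 1 "int j - int i" L] L0 by (simp add: n_def l_def algebra_simps)
  have n: "n \<ge> L" using mult_right_mono[of 1 "int j + 1" L] L0 by (simp add: n_def)
  define z where "z = c \<otimes> (act (- n) d \<otimes> inv (act (- l) d))"
  have sz: "symb k z = symb k c \<otimes>\<^bsub>Q\<^esub> (symb (k - n) d \<otimes>\<^bsub>Q\<^esub> inv\<^bsub>Q\<^esub> symb (k - l) d)" for k
    using G by (simp add: z_def)
  have zK: "z \<in> K" using cdK K by (simp add: z_def stableD stable_act)
  then have zG: "z \<in> carrier G" using KG by blast
  show ?thesis
  proof (intro bexI[of _ z] exI[of _ n] conjI ballI zK)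
    fix k assume k: "k \<in> {-int m..int m}"
    show "symb k z = symb k x"
      using ij(2)[OF k] G cd(3)[OF k] by (simp add: sz n_def l_def Q.r_inv)
    have "k + n \<ge> M" "k + n - l \<ge> M'" using k n nl by (auto simp: L_def)
    then have "symb k (act n z) = symb k d"
      using M zG G by (simp add: sz)
    then show "symb k (act n z) = symb k y" using cd(4)[OF k] by simp
  qed
qed

text \<open>Baire category: for each pattern of \<open>K\<close> on a central window, the points
  whose orbit shows it form a set \<open>P m w\<close> that is open and, by
  \<open>nub_mixing\<close>, dense in \<open>K\<close>. There are countably many such sets, and a
  point in all of them has a dense orbit.\<close>

lemma nub_imp_transitive:
  assumes K: "stable K" "nub K = K"
  shows "top_transitive (subtopology X K) \<alpha>"
proof -
  note KG = stableD(4)[OF K(1)]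
  let ?Y = "subtopology X K"
  have top: "topspace ?Y = K" using KG by auto
  \<comment> \<open>Restricting words makes patterns extensional functions, so that
    \<open>finite_patterns\<close> leaves finitely many for each \<open>m\<close>.\<close>
  let ?pat = "\<lambda>m::nat. \<lambda>y. restrict (\<lambda>k. symb k y) {-int m..int m}"
  define P where "P m w = K \<inter> (\<Union>n. {x \<in> topspace X. act n x \<in> {y \<in> carrier G. \<forall>k\<in>{-int m..int m}. symb k y = w k}})"
    for m :: nat and w
  define \<P> where "\<P> = (\<Union>m. P m ` ?pat m ` K)"
  have "?Y closure_of \<Inter>\<P> = topspace ?Y"
  proof (rule Baire_category)
    have "compact_space ?Y" "Hausdorff_space ?Y"
      using closedin_compact_space[OF compact stableD(2)[OF K(1)]] Hausdorff
      by (simp_all add: compact_space_subtopology Hausdorff_space_subtopology)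
    then show "completely_metrizable_space ?Y \<or> locally_compact_space ?Y \<and> regular_space ?Y"
      using compact_Hausdorff_or_regular_imp_normal_space compact_imp_locally_compact_space
        compact_Hausdorff_imp_regular_space by blast
    have "countable (P m ` ?pat m ` K)" for m
      using finite_patterns[OF _ KG, of "{-int m..int m}"] by (intro countable_finite) simp
    then show "countable \<P>" unfolding \<P>_def by blast
    fix T assume "T \<in> \<P>"
    then obtain m y where y: "y \<in> K" and T: "T = P m (?pat m y)" unfolding \<P>_def by blast
    have TK: "T \<subseteq> K" unfolding T P_def by blast
    have "openin X (\<Union>n. {x \<in> topspace X. act n x \<in> {y' \<in> carrier G. \<forall>k\<in>{-int m..int m}. symb k y' = ?pat m y k}})"
      using openin_continuous_map_preimage[OF continuous_act openin_cylinder] by blast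
    then have "openin ?Y T"
      unfolding T P_def by (rule openin_subtopology_Int2)
    moreover have "x \<in> ?Y closure_of T" if x: "x \<in> K" for x
      unfolding in_closure_of top
    proof (intro conjI allI impI x)
      fix U assume U: "x \<in> U \<and> openin ?Y U"
      then obtain V where V: "openin X V" "U = V \<inter> K" by (auto simp: openin_subtopology)
      then obtain m' where m': "\<forall>y\<in>carrier G. (\<forall>k\<in>{-int m'..int m'}. symb k y = symb k x) \<longrightarrow> y \<in> V"
        using cylinder_base[of V x] U by blast
      \<comment> \<open>The radius \<open>m + m'\<close> serves two purposes: closeness to
        \<open>x\<close> needs \<open>m'\<close>, the pattern of \<open>y\<close> needs
        \<open>m\<close>.\<close>
      obtain z n where z: "z \<in> K" "\<forall>k\<in>{-int (m + m')..int (m + m')}. symb k z = symb k x"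
        "\<forall>k\<in>{-int (m + m')..int (m + m')}. symb k (act n z) = symb k y"
        using nub_mixing[OF K x y, of "m + m'"] by blast
      have zG: "z \<in> carrier G" using z(1) KG by blast
      have "act n z \<in> {y' \<in> carrier G. \<forall>k\<in>{-int m..int m}. symb k y' = ?pat m y k}"
        using z(3) zG by simp
      then have "z \<in> T" unfolding T P_def topspace_eq using z(1) zG by blast
      moreover have "z \<in> U" using m' z zG V(2) by auto
      ultimately show "\<exists>y. y \<in> T \<and> y \<in> U" by blast
    qed
    then have "?Y closure_of T = topspace ?Y"
      using closure_of_subset_topspace[of ?Y T] top by blast
    ultimately show "openin ?Y T \<and> ?Y closure_of T = topspace ?Y" by blast
  qed
  then have "?Y closure_of \<Inter>\<P> \<noteq> {}" using top stableD(5)[OF K(1)] by auto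
  moreover have "K \<noteq> {}" using stableD(5)[OF K(1)] by blast
  ultimately obtain x where x: "x \<in> \<Inter>\<P>"
    using closure_of_empty by (metis equals0I)
  have xK: "x \<in> K" using x stableD(5)[OF K(1)] unfolding \<P>_def P_def by blast
  have "y \<in> ?Y closure_of (range (\<lambda>k. act k x))" if y: "y \<in> K" for y
    unfolding in_closure_of top
  proof (intro conjI allI impI y)
    fix U assume U: "y \<in> U \<and> openin ?Y U"
    then obtain V where V: "openin X V" "U = V \<inter> K" by (auto simp: openin_subtopology)
    then obtain m where m: "\<forall>x\<in>carrier G. (\<forall>k\<in>{-int m..int m}. symb k x = symb k y) \<longrightarrow> x \<in> V"
      using cylinder_base[of V y] U by blast
    have "x \<in> P m (?pat m y)" using x y unfolding \<P>_def by blast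
    then obtain n where "act n x \<in> carrier G" "\<forall>k\<in>{-int m..int m}. symb k (act n x) = symb k y"
      unfolding P_def by auto
    then have "act n x \<in> U" using m V(2) stable_act[OF K(1) xK] by blast
    then show "\<exists>z. z \<in> range (\<lambda>k. act k x) \<and> z \<in> U" by blast
  qed
  then have "?Y closure_of (range (\<lambda>k. act k x)) = topspace ?Y"
    using closure_of_subset_topspace[of ?Y "range (\<lambda>k. act k x)"] top by blast
  then show ?thesis
    unfolding top_transitive_def using xK orbit_eq[OF K(1) xK] top by metis
qed

end

lemma (in group) normal_in_subgroup_iff:
  assumes H: "subgroup H G" and K: "subgroup K G"
  shows "K \<lhd> G\<lparr>carrier := H\<rparr> \<longleftrightarrow> K \<subseteq> H \<and> (\<forall>h\<in>H. \<forall>k\<in>K. h \<otimes> k \<otimes> inv h \<in> K)"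
proof -
  interpret H: group "G\<lparr>carrier := H\<rparr>"
    using H is_group by (rule subgroup.subgroup_is_group)
  have "K \<subseteq> H \<Longrightarrow> subgroup K (G\<lparr>carrier := H\<rparr>)"
    using H K subgroup_incl by blast
  moreover have "subgroup K (G\<lparr>carrier := H\<rparr>) \<Longrightarrow> K \<subseteq> H"
    using subgroup.subset by fastforce
  ultimately show ?thesis
    unfolding H.normal_inv_iff using m_inv_consistent[OF H] by auto
qed

context expansive_group
begin

subsection \<open>Co-commensurable coset spaces\<close>

lemma image_rcoset:
  assumes "\<alpha> ` U = U" "U \<subseteq> carrier G" "x \<in> carrier G"
  shows "\<alpha> ` (U #> x) = U #> \<alpha> x"
proof -
  have "\<alpha> ` (U #> x) = (\<lambda>u. \<alpha> u \<otimes> \<alpha> x) ` U"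
    using assms(2,3) by (auto simp: r_coset_def aut_mult subset_iff image_iff)
  also have "\<dots> = (\<lambda>u. u \<otimes> \<alpha> x) ` (\<alpha> ` U)" by (simp add: image_image)
  also have "\<dots> = U #> \<alpha> x" using assms(1) by (auto simp: r_coset_def)
  finally show ?thesis .
qed

lemma coset_hom:
  assumes U: "subgroup U G" "subgroup U' G" "U \<lhd> G\<lparr>carrier := U'\<rparr>" and P: "subgroup P G" "P \<subseteq> U'"
  shows "group_hom (G\<lparr>carrier := P\<rparr>) (G\<lparr>carrier := U'\<rparr> Mod U) (\<lambda>x. U #> x)"
proof -
  interpret P: group "G\<lparr>carrier := P\<rparr>" using P(1) is_group by (rule subgroup.subgroup_is_group)
  interpret N: normal U "G\<lparr>carrier := U'\<rparr>" by fact
  interpret F: group "G\<lparr>carrier := U'\<rparr> Mod U" by (rule N.factorgroup_is_group)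
  have cos: "r_coset (G\<lparr>carrier := U'\<rparr>) U x = U #> x" for x by (simp add: r_coset_def)
  have mult: "set_mult (G\<lparr>carrier := U'\<rparr>) A B = A <#> B" for A B by (simp add: set_mult_def)
  have "(\<lambda>x. U #> x) \<in> hom (G\<lparr>carrier := P\<rparr>) (G\<lparr>carrier := U'\<rparr> Mod U)"
    using P(2) N.rcos_sum[unfolded cos mult]
    by (auto simp: hom_def carrier_FactGroup cos mult mult_FactGroup)
  then show ?thesis by unfold_locales
qed

text \<open>The witness is \<open>P\<close> modulo \<open>P \<inter> U \<inter> V\<close>, realised
  as the image of \<open>P\<close> under the pair of coset maps so that its carrier consists of
  pairs, as \<open>co_commensurable\<close> demands. The projections are onto since \<open>P\<close>
  meets every coset; their kernels are the images of \<open>P \<inter> U\<close> and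
  \<open>P \<inter> V\<close>, finite because \<open>q\<close> sends \<open>E\<close> and
  \<open>E'\<close> to the identity.\<close>

lemma co_commensurable_cosets:
  assumes U: "stable U" "stable U'" "U \<lhd> G\<lparr>carrier := U'\<rparr>"
    and V: "stable V" "stable V'" "V \<lhd> G\<lparr>carrier := V'\<rparr>"
    and P: "stable P" "P \<subseteq> U'" "P \<subseteq> V'" "U' \<subseteq> U <#> P" "V' \<subseteq> V <#> P"
    and E: "finite F" "P \<inter> U \<subseteq> F <#> E" "E \<subseteq> P \<inter> U \<inter> V"
    and E': "finite F'" "P \<inter> V \<subseteq> F' <#> E'" "E' \<subseteq> P \<inter> U \<inter> V"
    and F: "F \<subseteq> carrier G" "F' \<subseteq> carrier G"
  shows "co_commensurable
    (G\<lparr>carrier := U'\<rparr> Mod U) (qtop (subtopology X U') (\<lambda>x. U #> x)) (sq_map \<alpha>)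
    (G\<lparr>carrier := V'\<rparr> Mod V) (qtop (subtopology X V') (\<lambda>x. V #> x)) (sq_map \<alpha>)"
proof -
  let ?G1 = "G\<lparr>carrier := U'\<rparr> Mod U" and ?G2 = "G\<lparr>carrier := V'\<rparr> Mod V"
  let ?X1 = "qtop (subtopology X U') (\<lambda>x. U #> x)" and ?X2 = "qtop (subtopology X V') (\<lambda>x. V #> x)"
  let ?P = "G\<lparr>carrier := P\<rparr>" and ?XP = "subtopology X P"
  define q where "q x = (U #> x, V #> x)" for x
  let ?K = "?G1 \<times>\<times> ?G2"
  let ?H = "?K\<lparr>carrier := q ` P\<rparr>" and ?Y = "qtop ?XP q"
  let ?\<beta> = "map_prod (sq_map \<alpha>) (sq_map \<alpha>)"
  note PG = stableD(4)[OF P(1)] and PU = P(2) and PV = P(3)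
  have topP: "topspace ?XP = P" using PG by auto
  interpret q1: group_hom ?P ?G1 "\<lambda>x. U #> x"
    by (rule coset_hom[OF stableD(1)[OF U(1)] stableD(1)[OF U(2)] U(3) stableD(1)[OF P(1)] PU])
  interpret q2: group_hom ?P ?G2 "\<lambda>x. V #> x"
    by (rule coset_hom[OF stableD(1)[OF V(1)] stableD(1)[OF V(2)] V(3) stableD(1)[OF P(1)] PV])
  interpret P: compact_topgroup ?P ?XP
    by (rule closed_subgroup_compact_topgroup[OF stableD(1,2)[OF P(1)]])
  interpret K: group ?K by (rule DirProd_group[OF q1.H.is_group q2.H.is_group])
  have "q \<in> hom ?P ?K"
    using q1.hom_closed q2.hom_closed q1.hom_mult q2.hom_mult by (auto simp: hom_def q_def DirProd_def)
  then interpret q: group_hom ?P ?K q by unfold_locales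
  have mem_iff: "x \<in> W \<longleftrightarrow> W #> x = W" if "subgroup W G" "x \<in> carrier G" for W x
    using that by (metis rcos_self subgroup.rcos_const is_group)
  have one_iff: "q x = \<one>\<^bsub>?K\<^esub> \<longleftrightarrow> x \<in> U \<inter> V" if "x \<in> P" for x
    using mem_iff[OF stableD(1)[OF U(1)], of x] mem_iff[OF stableD(1)[OF V(1)], of x] that PG
    by (auto simp: q_def DirProd_def one_FactGroup)
  have "kernel ?P ?K q = P \<inter> U \<inter> V"
    using one_iff unfolding kernel_def by auto
  moreover have "closedin X (P \<inter> U \<inter> V)"
    by (intro closedin_Int stableD(2) P U V)
  ultimately have "closedin ?XP (kernel ?P ?K q)"
    using closedin_subset_topspace[of X "P \<inter> U \<inter> V" P] by auto
  from P.compact_topgroup_image[OF q.group_hom_axioms this]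
  have HY: "compact_topgroup ?H ?Y" by simp
  then interpret H: compact_topgroup ?H ?Y .
  have quo: "quotient_map ?XP ?Y q" by (rule quotient_map_qtop)
  have \<beta>q: "?\<beta> (q x) = q (\<alpha> x)" if "x \<in> P" for x
    using image_rcoset[OF stableD(3,4)[OF U(1)]] image_rcoset[OF stableD(3,4)[OF V(1)]] that PG
    by (simp add: q_def sq_map_def subset_iff)
  have aP: "\<alpha> x \<in> P" if "x \<in> P" for x using stableD(3)[OF P(1)] that by blast
  have inj_cosets: "inj_on (sq_map \<alpha>) (Pow (carrier G))"
    unfolding sq_map_def using bij_aut by (simp add: bij_betw_def inj_on_image_Pow)
  have qPow: "q x \<in> Pow (carrier G) \<times> Pow (carrier G)" if "x \<in> P" for x
    using that PG stableD(4)[OF U(1)] stableD(4)[OF V(1)] r_coset_subset_G by (auto simp: q_def) blast+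
  have inj: "inj_on ?\<beta> (q ` P)"
    using map_prod_inj_on[OF inj_cosets inj_cosets] qPow by (meson image_subsetI inj_on_subset)
  have img: "?\<beta> ` q ` P = q ` P"
  proof -
    have "?\<beta> ` q ` P = q ` \<alpha> ` P" using \<beta>q by (auto simp: image_image)
    then show ?thesis using stableD(3)[OF P(1)] by simp
  qed
  have "?\<beta> (y \<otimes>\<^bsub>?K\<^esub> z) = ?\<beta> y \<otimes>\<^bsub>?K\<^esub> ?\<beta> z" if "y \<in> q ` P" "z \<in> q ` P" for y z
  proof -
    from that obtain a b where ab: "a \<in> P" "b \<in> P" "y = q a" "z = q b" by blast
    have "?\<beta> (y \<otimes>\<^bsub>?K\<^esub> z) = ?\<beta> (q (a \<otimes> b))" using ab q.hom_mult by simp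
    also have "\<dots> = q (\<alpha> a \<otimes> \<alpha> b)"
      using ab PG \<beta>q stableD(8)[OF P(1)] by (simp add: aut_mult subset_iff)
    also have "\<dots> = ?\<beta> y \<otimes>\<^bsub>?K\<^esub> ?\<beta> z" using ab \<beta>q aP q.hom_mult by simp
    finally show ?thesis .
  qed
  then have iso: "?\<beta> \<in> iso ?H ?H"
    using img inj by (auto simp: iso_def hom_def bij_betw_def)
  have "continuous_map ?XP ?XP \<alpha>"
    using continuous_act[of 1] PG aP
    by (auto simp: continuous_map_in_subtopology intro!: continuous_map_from_subtopology
        continuous_map_eq[OF continuous_act[of 1]])
  then have "continuous_map ?XP ?Y (q \<circ> \<alpha>)"
    using quo continuous_map_compose quotient_imp_continuous_map by blast
  then have "continuous_map ?XP ?Y (?\<beta> \<circ> q)"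
    by (rule continuous_map_eq) (use \<beta>q topP in auto)
  then have "continuous_map ?Y ?Y ?\<beta>" by (rule continuous_compose_quotient_map[OF quo])
  \<comment> \<open>The inverse is continuous automatically, since the quotient is compact and
    Hausdorff.\<close>
  then have "homeomorphic_map ?Y ?Y ?\<beta>"
    using H.compact H.Hausdorff img inj topP by (intro continuous_imp_homeomorphic_map) simp_all
  then have aut\<beta>: "topaut ?H ?Y ?\<beta>" using iso by (simp add: topaut_def)
  have cont: "continuous_map ?XP (qtop (subtopology X W) (\<lambda>x. L #> x)) (\<lambda>x. L #> x)"
    if "P \<subseteq> W" for L W
    using quotient_imp_continuous_map[OF quotient_map_qtop] that
    by (rule continuous_map_from_subtopology_mono)
  have "continuous_map ?XP ?X1 (fst \<circ> q)" using cont[OF PU] by (simp add: q_def o_def)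
  then have c1: "continuous_map ?Y ?X1 fst" by (rule continuous_compose_quotient_map[OF quo])
  have "continuous_map ?XP ?X2 (snd \<circ> q)" using cont[OF PV] by (simp add: q_def o_def)
  then have c2: "continuous_map ?Y ?X2 snd" by (rule continuous_compose_quotient_map[OF quo])
  have h1: "fst \<in> hom ?H ?G1" using q1.hom_closed by (auto simp: hom_def q_def DirProd_def)
  have h2: "snd \<in> hom ?H ?G2" using q2.hom_closed by (auto simp: hom_def q_def DirProd_def)
  have surj: "(\<lambda>x. W #> x) ` P = carrier (G\<lparr>carrier := W'\<rparr> Mod W)"
    if W: "stable W" "P \<subseteq> W'" "W' \<subseteq> W <#> P" for W W'
  proof -
    have "W #> x \<in> (\<lambda>x. W #> x) ` P" if "x \<in> W'" for x
    proof -
      obtain w p where wp: "w \<in> W" "p \<in> P" "x = w \<otimes> p"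
        using W(3) \<open>x \<in> W'\<close> by (auto simp: set_mult_def)
      then have "W #> x = W #> w #> p"
        using stableD(4)[OF W(1)] PG by (simp add: coset_mult_assoc subset_iff)
      also have "W #> w = W" using wp(1) stableD(1)[OF W(1)] by (metis is_group subgroup.rcos_const)
      finally show ?thesis using wp(2) by blast
    qed
    then show ?thesis using W(2) by (auto simp: carrier_FactGroup r_coset_def)
  qed
  have s1: "fst ` carrier ?H = carrier ?G1"
    using surj[OF U(1) PU P(4)] by (simp add: q_def image_image)
  have s2: "snd ` carrier ?H = carrier ?G2"
    using surj[OF V(1) PV P(5)] by (simp add: q_def image_image)
  have fin: "finite (q ` (P \<inter> W))"
    if "finite F" "P \<inter> W \<subseteq> F <#> E" "E \<subseteq> P \<inter> U \<inter> V" "F \<subseteq> carrier G" for F E W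
  proof (rule finite_subset)
    show "q ` (P \<inter> W) \<subseteq> q ` F"
    proof (rule image_subsetI)
      fix x assume x: "x \<in> P \<inter> W"
      then obtain f e where fe: "f \<in> F" "e \<in> E" "x = f \<otimes> e" using \<open>P \<inter> W \<subseteq> F <#> E\<close> by (auto simp: set_mult_def)
      have "e \<in> P \<inter> U \<inter> V" using that(3) fe(2) by blast
      then have e: "e \<in> P" "q e = \<one>\<^bsub>?K\<^esub>" using one_iff[of e] by blast+
      \<comment> \<open>\<open>F\<close> is only known to lie in \<open>carrier G\<close>, but
        \<open>f\<close> is recovered from \<open>x\<close> and \<open>e\<close> and so belongs to
        \<open>P\<close>, where \<open>q\<close> is multiplicative.\<close>
      have "f = x \<otimes> inv e" using fe e(1) that(4) PG by (auto simp: m_assoc subset_iff)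
      then have f: "f \<in> P" using x e(1) stableD(7,8)[OF P(1)] by auto
      have "q x = q f \<otimes>\<^bsub>?K\<^esub> q e" using q.hom_mult[of f e] fe(3) f e(1) by simp
      also have "\<dots> = q f" using q.hom_closed[of f] f e(2) K.r_one by simp
      finally show "q x \<in> q ` F" using fe(1) by blast
    qed
    show "finite (q ` F)" using that(1) by simp
  qed
  have k1: "kernel ?H ?G1 fst = q ` (P \<inter> U)"
    using mem_iff[OF stableD(1)[OF U(1)]] PG
    by (auto simp: kernel_def q_def one_FactGroup subset_iff)
  have k2: "kernel ?H ?G2 snd = q ` (P \<inter> V)"
    using mem_iff[OF stableD(1)[OF V(1)]] PG
    by (auto simp: kernel_def q_def one_FactGroup subset_iff)
  show ?thesis
    unfolding co_commensurable_def
    by (intro exI[of _ ?H] exI[of _ ?Y] exI[of _ ?\<beta>] exI[of _ fst] exI[of _ snd] conjI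
        H.topgroup H.compact aut\<beta> h1 h2 c1 c2 s1 s2)
      (use fin[OF E F(1)] fin[OF E' F(2)] k1 k2 in auto)
qed

subsection \<open>Schreier refinement by nubs\<close>

text \<open>By \<open>self_nub_iff_transitive\<close> these are the closed, stable, transitive
  subgroups; the nub form is the one that can be checked on products.\<close>

definition self_nub :: "'a set \<Rightarrow> bool" where
  "self_nub K \<longleftrightarrow> stable K \<and> nub K = K"

lemma self_nub_iff_transitive:
  "self_nub K \<longleftrightarrow> stable K \<and> top_transitive (subtopology X K) \<alpha>"
  using transitive_imp_nub nub_imp_transitive unfolding self_nub_def by blast

definition normalises :: "'a set \<Rightarrow> 'a set \<Rightarrow> bool" where
  "normalises L K \<longleftrightarrow> (\<forall>l\<in>L. \<forall>k\<in>K. l \<otimes> k \<otimes> inv l \<in> K)"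

lemma stable_Int: "stable K \<Longrightarrow> stable L \<Longrightarrow> stable (K \<inter> L)"
  using inj_on_image_Int[OF bij_betw_imp_inj_on[OF bij_aut], of K L]
  by (auto simp: stable_def subgroups_Inter_pair closedin_Int subgroup.subset)

lemma subset_set_mult:
  assumes "stable K" "stable L"
  shows "K \<subseteq> K <#> L" "L \<subseteq> K <#> L"
proof -
  have "k \<otimes> \<one> \<in> K <#> L" if "k \<in> K" for k
    using that stableD(5)[OF assms(2)] unfolding set_mult_def by blast
  moreover have "\<one> \<otimes> l \<in> K <#> L" if "l \<in> L" for l
    using that stableD(5)[OF assms(1)] unfolding set_mult_def by blast
  ultimately show "K \<subseteq> K <#> L" "L \<subseteq> K <#> L"
    using stableD(6)[OF assms(1)] stableD(6)[OF assms(2)] by fastforce+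
qed

lemma stable_set_mult:
  assumes K: "stable K" and L: "stable L" and norm: "normalises L K"
  shows "stable (K <#> L)"
proof -
  have "\<alpha> ` (K <#> L) = (\<alpha> ` K) <#> (\<alpha> ` L)"
    using stableD(4)[OF K] stableD(4)[OF L]
    by (force simp: set_mult_def aut_mult subset_iff image_iff)
  then show ?thesis
    using subgroup_set_mult[OF stableD(1)[OF K] stableD(1)[OF L]] norm
      closedin_set_mult[OF stableD(2)[OF K] stableD(2)[OF L]] stableD(3)[OF K] stableD(3)[OF L]
    unfolding stable_def normalises_def by simp
qed

lemma self_nub_set_mult:
  assumes K: "self_nub K" and L: "self_nub L" and norm: "normalises L K"
  shows "self_nub (K <#> L)"
proof -
  have st: "stable (K <#> L)" using assms stable_set_mult by (simp add: self_nub_def)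
  have "K <#> L \<subseteq> nub (K <#> L)"
    using nub_mult[of K L] K L stableD(4) unfolding self_nub_def set_mult_def by blast
  then show ?thesis using st nub_subset[OF st] by (auto simp: self_nub_def)
qed

lemma self_nub_nub: "stable K \<Longrightarrow> self_nub (nub K)"
  by (simp add: self_nub_def nub_stable nub_nub)

lemma normalises_nub: "K \<subseteq> carrier G \<Longrightarrow> L \<subseteq> carrier G \<Longrightarrow> normalises L K \<Longrightarrow> normalises L (nub K)"
  using nub_conj[of K] unfolding normalises_def by blast

text \<open>One block of the refinement: as \<open>B\<close> climbs the other series from the
  trivial group to \<open>G\<close>, the layer climbs from \<open>A\<close> to
  \<open>A'\<close>.\<close>

definition layer :: "'a set \<Rightarrow> 'a set \<Rightarrow> 'a set \<Rightarrow> 'a set" where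
  "layer A A' B = A <#> nub (A' \<inter> B)"

definition normal_step :: "'a set \<Rightarrow> 'a set \<Rightarrow> bool" where
  "normal_step A A' \<longleftrightarrow> self_nub A \<and> self_nub A' \<and> A \<subseteq> A' \<and> normalises A' A"

lemma layer_self_nub:
  assumes A: "normal_step A A'" and B: "stable B"
  shows "self_nub (layer A A' B)"
proof -
  have st: "stable (A' \<inter> B)" using A B stable_Int by (simp add: normal_step_def self_nub_def)
  show ?thesis
    unfolding layer_def
    using A self_nub_nub[OF st] nub_subset[OF st]
    by (intro self_nub_set_mult) (auto simp: normal_step_def normalises_def)
qed

lemma stable_trivial: "stable {\<one>}"
proof -
  have "\<alpha> \<one> = \<one>" using hom_one[OF act_hom[of 1] is_group is_group] by simp
  moreover have "closedin X {\<one>}"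
    using Hausdorff by (simp add: Hausdorff_imp_t1_space closedin_t1_singleton)
  ultimately show ?thesis by (simp add: stable_def triv_subgroup)
qed

lemma layer_bot:
  assumes "normal_step A A'"
  shows "layer A A' {\<one>} = A"
proof -
  have A: "stable A" "stable A'" using assms by (simp_all add: normal_step_def self_nub_def)
  have "A' \<inter> {\<one>} = {\<one>}" using stableD(5)[OF A(2)] by blast
  moreover have "nub {\<one>} = {\<one>}"
    using nub_subset[OF stable_trivial] stableD(5)[OF nub_stable[OF stable_trivial]] by blast
  ultimately show ?thesis
    using stableD(6)[OF A(1)] by (auto simp: layer_def set_mult_def)
qed

text \<open>Transitivity of \<open>A'\<close> enters here: \<open>A' \<inter> carrier G\<close> is
  its own nub, so nothing is lost at the end of a block and the original terms survive in the
  refinement.\<close>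

lemma layer_top:
  assumes "normal_step A A'"
  shows "layer A A' (carrier G) = A'"
proof -
  have A: "stable A" "stable A'" "nub A' = A'" "A \<subseteq> A'"
    using assms by (simp_all add: normal_step_def self_nub_def)
  have "A' \<inter> carrier G = A'" using stableD(4)[OF A(2)] by blast
  then have "layer A A' (carrier G) = A <#> A'" using A by (simp add: layer_def)
  moreover have "A <#> A' \<subseteq> A'"
    using A(4) stableD(8)[OF A(2)] by (auto simp: set_mult_def)
  ultimately show ?thesis using subset_set_mult(2)[OF A(1,2)] by simp
qed

text \<open>Write an element of the upper layer as \<open>a \<otimes> d\<close>. Conjugation by
  \<open>d\<close> preserves \<open>A\<close>, as \<open>d\<close> lies in \<open>A'\<close>, and
  preserves \<open>nub (A' \<inter> B)\<close>, as \<open>d\<close> normalises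
  \<open>A' \<inter> B\<close>; the remaining conjugation by \<open>a\<close> is inner in the lower
  layer, which contains \<open>A\<close>.\<close>

lemma layer_normal_step:
  assumes A: "normal_step A A'" and B: "normal_step B B'"
  shows "normal_step (layer A A' B) (layer A A' B')"
proof -
  let ?C = "nub (A' \<inter> B)" and ?D = "nub (A' \<inter> B')"
  let ?Z = "layer A A' B"
  have st: "stable A" "stable A'" "stable B" "stable B'"
    using A B by (simp_all add: normal_step_def self_nub_def)
  have stI: "stable (A' \<inter> B)" "stable (A' \<inter> B')" using st stable_Int by blast+
  have stZ: "stable ?Z" using layer_self_nub[OF A st(3)] by (simp add: self_nub_def)
  have CD: "?C \<subseteq> ?D" using B by (intro nub_mono) (auto simp: normal_step_def)
  have sub: "?Z \<subseteq> layer A A' B'"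
    using CD unfolding layer_def by (intro mono_set_mult subset_refl)
  have "normalises (A' \<inter> B') (A' \<inter> B)"
    using B stableD[OF st(2)] unfolding normalises_def normal_step_def by auto
  then have normI: "normalises (A' \<inter> B') ?C"
    using stableD(4)[OF stI(1)] stableD(4)[OF stI(2)] normalises_nub by blast
  have "g \<otimes> x \<otimes> inv g \<in> ?Z" if g: "g \<in> layer A A' B'" and x: "x \<in> ?Z" for g x
  proof -
    obtain a d where ad: "a \<in> A" "d \<in> ?D" "g = a \<otimes> d" using g by (auto simp: layer_def set_mult_def)
    obtain a' c where ac: "a' \<in> A" "c \<in> ?C" "x = a' \<otimes> c" using x by (auto simp: layer_def set_mult_def)
    have d: "d \<in> A' \<inter> B'" using ad(2) nub_subset[OF stI(2)] by blast
    have c: "c \<in> A' \<inter> B" using ac(2) nub_subset[OF stI(1)] by blast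
    have G: "a \<in> carrier G" "d \<in> carrier G" "a' \<in> carrier G" "c \<in> carrier G" "x \<in> carrier G"
      using ad(1) d ac(1) c stableD(6) st x stZ by blast+
    have "d \<otimes> a' \<otimes> inv d \<in> A"
      using A d ac(1) unfolding normal_step_def normalises_def by blast
    moreover have "d \<otimes> c \<otimes> inv d \<in> ?C" using normI d ac(2) unfolding normalises_def by blast
    moreover have "d \<otimes> x \<otimes> inv d = (d \<otimes> a' \<otimes> inv d) \<otimes> (d \<otimes> c \<otimes> inv d)"
      using G by (simp add: ac(3) m_assoc inv_mult_cancel)
    ultimately have "d \<otimes> x \<otimes> inv d \<in> ?Z" unfolding layer_def set_mult_def by blast
    moreover have "a \<in> ?Z"
      using ad(1) subset_set_mult(1)[OF st(1) nub_stable[OF stI(1)]] by (auto simp: layer_def)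
    ultimately have "a \<otimes> (d \<otimes> x \<otimes> inv d) \<otimes> inv a \<in> ?Z" using stableD(7,8)[OF stZ] by blast
    moreover have "g \<otimes> x \<otimes> inv g = a \<otimes> (d \<otimes> x \<otimes> inv d) \<otimes> inv a"
      using G by (simp add: ad(3) m_assoc inv_mult_group)
    ultimately show ?thesis by simp
  qed
  then show ?thesis
    using layer_self_nub[OF A st(3)] layer_self_nub[OF A st(4)] sub
    by (simp add: normal_step_def normalises_def)
qed

lemma normal_step_normal:
  assumes "normal_step A A'"
  shows "A \<lhd> G\<lparr>carrier := A'\<rparr>"
  using assms normal_in_subgroup_iff[of A' A] stableD(1)
  unfolding normal_step_def self_nub_def normalises_def by blast

text \<open>The computation behind Zassenhaus' lemma. For \<open>x = a \<otimes> t\<close> in the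
  intersection, with \<open>a\<close> in \<open>A\<close> and \<open>t\<close> in
  \<open>nub (A' \<inter> B)\<close>, the factor \<open>a = x \<otimes> inv t\<close> also lies in
  \<open>B'\<close>, and finite index of the nub in \<open>A \<inter> B'\<close> splits it further.
  \<open>F\<close> records what the passage to nubs costs.\<close>

lemma layer_common_subgroup:
  assumes A: "normal_step A A'" and B: "normal_step B B'"
  shows "\<exists>F. finite F \<and> F \<subseteq> carrier G \<and>
    nub (A' \<inter> B') \<inter> layer A A' B \<subseteq> F <#> (nub (A \<inter> B') <#> nub (A' \<inter> B)) \<and>
    nub (A \<inter> B') <#> nub (A' \<inter> B) \<subseteq> nub (A' \<inter> B') \<inter> layer A A' B \<inter> layer B B' A"
proof -
  let ?P = "nub (A' \<inter> B')" and ?C = "nub (A \<inter> B')" and ?D = "nub (A' \<inter> B)"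
  have st: "stable A" "stable A'" "stable B" "stable B'"
    using A B by (simp_all add: normal_step_def self_nub_def)
  have sub: "A \<subseteq> A'" "B \<subseteq> B'" using A B by (simp_all add: normal_step_def)
  have stI: "stable (A' \<inter> B)" "stable (A' \<inter> B')" "stable (A \<inter> B')" using st stable_Int by blast+
  note nubs = nub_subset[OF stI(1)] nub_subset[OF stI(2)] nub_subset[OF stI(3)]
  obtain F where F: "finite F" "F \<subseteq> A \<inter> B'" "A \<inter> B' = F <#> ?C"
    using nub_finite_index[OF stI(3)] by blast
  have "?P \<inter> layer A A' B \<subseteq> F <#> (?C <#> ?D)"
  proof
    fix x assume x: "x \<in> ?P \<inter> layer A A' B"
    then obtain a t where at: "a \<in> A" "t \<in> ?D" "x = a \<otimes> t" by (auto simp: layer_def set_mult_def)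
    have xt: "x \<in> B'" "t \<in> B'" using x at(2) nubs sub by blast+
    have G: "a \<in> carrier G" "t \<in> carrier G" using at(1) xt stableD(6) st by blast+
    have "a = x \<otimes> inv t" using at(3) G by (simp add: m_assoc)
    then have "a \<in> A \<inter> B'" using at(1) xt stableD(7,8)[OF st(4)] by blast
    then have "a \<in> F <#> ?C" using F(3) by simp
    then obtain f c where fc: "f \<in> F" "c \<in> ?C" "a = f \<otimes> c" by (auto simp: set_mult_def)
    have "f \<in> carrier G" "c \<in> carrier G" using fc nubs F(2) stableD(4)[OF st(1)] by blast+
    then have "x = f \<otimes> (c \<otimes> t)" using at(3) fc(3) G by (simp add: m_assoc)
    then show "x \<in> F <#> (?C <#> ?D)" using fc(1,2) at(2) unfolding set_mult_def by blast
  qed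
  moreover have "c \<otimes> t \<in> ?P \<inter> layer A A' B \<inter> layer B B' A" if c: "c \<in> ?C" and t: "t \<in> ?D" for c t
  proof -
    have "c \<in> ?P" "t \<in> ?P" using c t nub_mono[of "A \<inter> B'" "A' \<inter> B'"] nub_mono[of "A' \<inter> B" "A' \<inter> B'"] sub by blast+
    then have "c \<otimes> t \<in> ?P" using stableD(8)[OF nub_stable[OF stI(2)]] by blast
    moreover have "c \<in> A" "t \<in> B" using c t nubs by blast+
    then have "c \<otimes> t \<in> layer A A' B" using t unfolding layer_def set_mult_def by blast
    moreover have "c \<otimes> t \<in> layer B B' A"
    proof -
      have lay: "stable (layer B B' A)" using layer_self_nub[OF B st(1)] by (simp add: self_nub_def)
      have "stable (B' \<inter> A)" using st stable_Int by blast
      then have "B \<subseteq> layer B B' A" "nub (B' \<inter> A) \<subseteq> layer B B' A"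
        unfolding layer_def using subset_set_mult[OF st(3) nub_stable] by blast+
      moreover have "c \<in> nub (B' \<inter> A)" using c by (simp add: Int_commute)
      ultimately show ?thesis using \<open>t \<in> B\<close> stableD(8)[OF lay] by blast
    qed
    ultimately show ?thesis by blast
  qed
  then have "?C <#> ?D \<subseteq> ?P \<inter> layer A A' B \<inter> layer B B' A" unfolding set_mult_def by blast
  moreover have "F \<subseteq> carrier G" using F(2) stableD(4)[OF st(1)] by blast
  ultimately show ?thesis using F(1) by blast
qed

text \<open>The butterfly lemma, with co-commensurability in the place of isomorphism.\<close>

lemma layers_co_commensurable:
  assumes A: "normal_step A A'" and B: "normal_step B B'"
  shows "co_commensurable
    (G\<lparr>carrier := layer A A' B'\<rparr> Mod layer A A' B)
    (qtop (subtopology X (layer A A' B')) (\<lambda>x. layer A A' B #> x)) (sq_map \<alpha>)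
    (G\<lparr>carrier := layer B B' A'\<rparr> Mod layer B B' A)
    (qtop (subtopology X (layer B B' A')) (\<lambda>x. layer B B' A #> x)) (sq_map \<alpha>)"
proof -
  let ?P = "nub (A' \<inter> B')"
  have links: "normal_step (layer A A' B) (layer A A' B')" "normal_step (layer B B' A) (layer B B' A')"
    using layer_normal_step A B by blast+
  have st: "stable A" "stable A'" "stable B" "stable B'"
    using A B by (simp_all add: normal_step_def self_nub_def)
  have P: "stable ?P" using st stable_Int nub_stable by blast
  have stl: "stable (layer A A' B)" "stable (layer A A' B')" "stable (layer B B' A)" "stable (layer B B' A')"
    using links by (simp_all add: normal_step_def self_nub_def)
  have le: "A \<subseteq> layer A A' B" "B \<subseteq> layer B B' A"
    unfolding layer_def using st stable_Int nub_stable subset_set_mult by blast+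
  have l: "layer A A' B' = A <#> ?P" "layer B B' A' = B <#> ?P"
    by (simp_all add: layer_def Int_commute)
  obtain F where F: "finite F" "F \<subseteq> carrier G"
    "?P \<inter> layer A A' B \<subseteq> F <#> (nub (A \<inter> B') <#> nub (A' \<inter> B))"
    "nub (A \<inter> B') <#> nub (A' \<inter> B) \<subseteq> ?P \<inter> layer A A' B \<inter> layer B B' A"
    using layer_common_subgroup[OF A B] by blast
  \<comment> \<open>Exchanging the roles of the two series reverses the order of the nub factors, so
    the product set is not literally the previous one; hence the separate sets \<open>E\<close> and
    \<open>E'\<close> in \<open>co_commensurable_cosets\<close>.\<close>
  obtain F' where F': "finite F'" "F' \<subseteq> carrier G"
    "?P \<inter> layer B B' A \<subseteq> F' <#> (nub (B \<inter> A') <#> nub (B' \<inter> A))"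
    "nub (B \<inter> A') <#> nub (B' \<inter> A) \<subseteq> ?P \<inter> layer A A' B \<inter> layer B B' A"
    using layer_common_subgroup[OF B A] by (auto simp: Int_ac)
  show ?thesis
  proof (rule co_commensurable_cosets[OF stl(1,2) normal_step_normal[OF links(1)] stl(3,4) normal_step_normal[OF links(2)] P
        _ _ _ _ F(1,3,4) F'(1,3,4) F(2) F'(2)])
    show "?P \<subseteq> layer A A' B'" "?P \<subseteq> layer B B' A'"
      unfolding l using subset_set_mult st P by blast+
    show "layer A A' B' \<subseteq> layer A A' B <#> ?P" "layer B B' A' \<subseteq> layer B B' A <#> ?P"
      unfolding l by (intro mono_set_mult le subset_refl)+
  qed
qed

section \<open>Subnormal series and their refinements\<close>

lemma subnormal_series_steps:
  assumes "subnormal_series G X \<alpha> S r"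
  shows "S 0 = {\<one>}" "S r = carrier G" "\<And>j. j \<le> r \<Longrightarrow> self_nub (S j)"
    "\<And>j. j < r \<Longrightarrow> normal_step (S j) (S (Suc j))"
proof -
  show "S 0 = {\<one>}" "S r = carrier G"
    using assms by (simp_all add: subnormal_series_def)
  show perf: "self_nub (S j)" if "j \<le> r" for j
    using assms that by (simp add: subnormal_series_def self_nub_iff_transitive stable_def)
  show "normal_step (S j) (S (Suc j))" if "j < r" for j
  proof -
    have "Suc j \<in> {1..r}" using that by simp
    then have "S (Suc j - 1) \<lhd> G\<lparr>carrier := S (Suc j)\<rparr>"
      using assms unfolding subnormal_series_def by blast
    then show ?thesis
      using perf[of j] perf[of "Suc j"] that normal_in_subgroup_iff[of "S (Suc j)" "S j"]
      by (simp add: normal_step_def normalises_def self_nub_def stable_def)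
  qed
qed

text \<open>A dense orbit of \<open>U'\<close> maps to a dense orbit of cosets. This supplies the
  condition on the induced automorphisms in \<open>subnormal_seriesI\<close>.\<close>

lemma quotient_transitive:
  assumes U: "stable U" and U': "self_nub U'" and sub: "U \<subseteq> U'"
  shows "top_transitive (qtop (subtopology X U') (\<lambda>x. U #> x)) (sq_map \<alpha>)"
proof -
  have st: "stable U'" using U' by (simp add: self_nub_def)
  have top: "topspace (subtopology X U') = U'" using stableD(4)[OF st] by auto
  have comm: "(\<lambda>x. U #> x) (\<alpha> x) = sq_map \<alpha> (U #> x)" if "x \<in> U'" for x
    using image_rcoset[OF stableD(3,4)[OF U]] stableD(6)[OF st that] by (simp add: sq_map_def)
  have "sq_map \<alpha> ` (\<lambda>x. U #> x) ` U' = (\<lambda>x. U #> x) ` \<alpha> ` U'"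
    using comm by (auto simp: image_image)
  then have img: "sq_map \<alpha> ` (\<lambda>x. U #> x) ` U' = (\<lambda>x. U #> x) ` U'"
    using stableD(3)[OF st] by simp
  have "inj_on (sq_map \<alpha>) (Pow (carrier G))"
    unfolding sq_map_def using bij_aut by (simp add: bij_betw_def inj_on_image_Pow)
  moreover have "(\<lambda>x. U #> x) ` U' \<subseteq> Pow (carrier G)"
    using r_coset_subset_G[OF stableD(4)[OF U]] stableD(4)[OF st] by blast
  ultimately have "inj_on (sq_map \<alpha>) ((\<lambda>x. U #> x) ` U')" by (rule inj_on_subset)
  then have bij: "bij_betw (sq_map \<alpha>) ((\<lambda>x. U #> x) ` U') ((\<lambda>x. U #> x) ` U')"
    using img by (simp add: bij_betw_def)
  show ?thesis
  proof (rule top_transitive_image)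
    show "bij_betw \<alpha> (topspace (subtopology X U')) (topspace (subtopology X U'))"
      unfolding top by (rule stable_bij[OF st])
    show "bij_betw (sq_map \<alpha>) (topspace (qtop (subtopology X U') (\<lambda>x. U #> x)))
        (topspace (qtop (subtopology X U') (\<lambda>x. U #> x)))"
      unfolding topspace_qtop top by (rule bij)
    show "continuous_map (subtopology X U') (qtop (subtopology X U') (\<lambda>x. U #> x)) (\<lambda>x. U #> x)"
      using quotient_map_qtop by (rule quotient_imp_continuous_map)
    show "(\<lambda>x. U #> x) ` topspace (subtopology X U') = topspace (qtop (subtopology X U') (\<lambda>x. U #> x))"
      by simp
    show "top_transitive (subtopology X U') \<alpha>"
      using U' by (simp add: self_nub_iff_transitive)
  qed (use comm top in auto)
qed

lemma subnormal_seriesI: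
  assumes "R 0 = {\<one>}" "R m = carrier G" and perf: "\<And>j. j \<le> m \<Longrightarrow> self_nub (R j)"
    and links: "\<And>j. j < m \<Longrightarrow> normal_step (R j) (R (Suc j))"
  shows "subnormal_series G X \<alpha> R m"
  unfolding subnormal_series_def
proof (intro conjI allI impI ballI)
  fix j assume "j \<in> {1..m}"
  then obtain i where i: "j = Suc i" "i < m" by (cases j) auto
  then have l: "normal_step (R i) (R j)" using links by simp
  then show "R (j - 1) \<subseteq> R j" "R (j - 1) \<lhd> G\<lparr>carrier := R j\<rparr>"
    using i normal_step_normal by (auto simp: normal_step_def)
  show "top_transitive (sq_top G X R j) (sq_map \<alpha>)"
    using l i quotient_transitive[of "R i" "R j"] by (simp add: sq_top_def normal_step_def self_nub_def)
qed (use assms perf[unfolded self_nub_iff_transitive stable_def] in auto)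

text \<open>The last index is treated separately because \<open>S (Suc r)\<close> is arbitrary.\<close>

definition refine :: "(nat \<Rightarrow> 'a set) \<Rightarrow> nat \<Rightarrow> (nat \<Rightarrow> 'a set) \<Rightarrow> nat \<Rightarrow> nat \<Rightarrow> 'a set" where
  "refine S r S' s k = (if k = r * s then carrier G
     else layer (S (k div s)) (S (Suc (k div s))) (S' (k mod s)))"

text \<open>The end \<open>i = s\<close> of a block is included: there the layer is
  \<open>S (Suc j)\<close> by \<open>layer_top\<close>, which is also the value of
  \<open>refine\<close> at the start of the next block by \<open>layer_bot\<close>, or at the last
  index by its first clause. Consecutive terms can thus be compared within one block.\<close>

lemma refine_eq:
  assumes S: "subnormal_series G X \<alpha> S r" and S': "subnormal_series G X \<alpha> S' s"
    and j: "j < r" and i: "i \<le> s" and s: "0 < s"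
  shows "refine S r S' s (j * s + i) = layer (S j) (S (Suc j)) (S' i)"
proof (cases "i < s")
  case True
  have "Suc j * s \<le> r * s" using j by (intro mult_right_mono) auto
  then have "j * s + i \<noteq> r * s" using True by simp
  then show ?thesis using True by (simp add: refine_def)
next
  case False
  then have i: "i = s" using i by simp
  have top: "layer (S j) (S (Suc j)) (S' i) = S (Suc j)"
    unfolding i using layer_top subnormal_series_steps(4)[OF S j] subnormal_series_steps(2)[OF S'] by simp
  show ?thesis
  proof (cases "Suc j = r")
    case True
    then have "j * s + i = r * s" using i by auto
    then show ?thesis using top True subnormal_series_steps(2)[OF S] by (simp add: refine_def)
  next
    case False
    then have j': "Suc j < r" using j by simp
    have e: "j * s + i = Suc j * s" using i by simp
    have "Suc j * s < r * s" using j' s by (rule mult_less_mono1)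
    then have "j * s + i \<noteq> r * s" unfolding e by (rule less_imp_neq)
    moreover have "(j * s + i) div s = Suc j" "(j * s + i) mod s = 0"
      unfolding e using s by (simp_all only: nonzero_mult_div_cancel_right mod_mult_self2_is_0)
    ultimately have "refine S r S' s (j * s + i) = layer (S (Suc j)) (S (Suc (Suc j))) (S' 0)"
      by (simp add: refine_def)
    also have "\<dots> = S (Suc j)"
      using layer_bot[OF subnormal_series_steps(4)[OF S j']] subnormal_series_steps(1)[OF S'] by simp
    finally show ?thesis using top by simp
  qed
qed

lemma refine_refines:
  assumes S: "subnormal_series G X \<alpha> S r" and S': "subnormal_series G X \<alpha> S' s"
    and r: "0 < r" and s: "0 < s"
  shows "refines_series G X \<alpha> (refine S r S' s) (r * s) S r"
proof -
  note SD = subnormal_series_steps[OF S] and SD' = subnormal_series_steps[OF S']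
  let ?R = "refine S r S' s"
  have Rj: "?R (j * s) = S j" if "j \<le> r" for j
  proof (cases "j = r")
    case True
    then show ?thesis using SD(2) by (simp add: refine_def)
  next
    case False
    then have j: "j < r" using that by simp
    then show ?thesis
      using refine_eq[OF S S' j _ s, of 0] SD'(1) layer_bot[OF SD(4)[OF j]] by simp
  qed
  have links: "normal_step (?R k) (?R (Suc k))" if k: "k < r * s" for k
  proof -
    define j i where "j = k div s" and "i = k mod s"
    have ji: "j < r" "i < s" "k = j * s + i"
      using k s by (simp_all add: j_def i_def less_mult_imp_div_less)
    have "normal_step (layer (S j) (S (Suc j)) (S' i)) (layer (S j) (S (Suc j)) (S' (Suc i)))"
      using ji SD(4) SD'(4) by (intro layer_normal_step) auto
    then show ?thesis
      using refine_eq[OF S S' ji(1) _ s, of i] refine_eq[OF S S' ji(1) _ s, of "Suc i"] ji by simp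
  qed
  have "subnormal_series G X \<alpha> ?R (r * s)"
  proof (rule subnormal_seriesI)
    show "?R 0 = {\<one>}" using Rj[of 0] SD(1) by simp
    show R: "?R (r * s) = carrier G" by (simp add: refine_def)
    show "self_nub (?R k)" if "k \<le> r * s" for k
    proof (cases "k = r * s")
      case True
      then show ?thesis using R SD(2) SD(3)[of r] by simp
    next
      case False
      then show ?thesis using links[of k] that by (simp add: normal_step_def)
    qed
  qed (rule links)
  moreover have "\<exists>k\<le>r * s. S j = ?R k" if "j \<le> r" for j
    using Rj[OF that] that by (intro exI[of _ "j * s"]) simp
  ultimately show ?thesis by (simp add: refines_series_def)
qed

end

text \<open>Transposition of an \<open>r\<close> by \<open>s\<close> grid numbered row by row, with
  a shift because subquotients are counted from 1. The inverse has the same form with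
  \<open>r\<close> and \<open>s\<close> exchanged.\<close>

lemma transpose_index_bij:
  fixes r s :: nat
  assumes "0 < r" "0 < s"
  shows "bij_betw (\<lambda>k. Suc ((k - 1) mod s * r + (k - 1) div s)) {1..r * s} {1..r * s}"
proof (rule bij_betw_byWitness[where f' = "\<lambda>k. Suc ((k - 1) mod r * s + (k - 1) div r)"])
  \<comment> \<open>General \<open>a\<close> and \<open>b\<close> give both directions, once as
    \<open>r\<close>, \<open>s\<close> and once as \<open>s\<close>, \<open>r\<close>.\<close>
  have bound: "Suc ((k - 1) mod b * a + (k - 1) div b) \<in> {1..a * b} \<and>
      (((k - 1) mod b * a + (k - 1) div b) mod a * b + ((k - 1) mod b * a + (k - 1) div b) div a = k - 1)"
    if "0 < a" "0 < b" "k \<in> {1..a * b}" for a b k :: nat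
  proof -
    have d: "(k - 1) div b < a" using that by (intro less_mult_imp_div_less) auto
    have "Suc ((k - 1) mod b) * a \<le> b * a"
      using that(2) by (intro mult_right_mono) (auto simp: Suc_le_eq)
    then have "(k - 1) mod b * a + (k - 1) div b < b * a" using d by simp
    then show ?thesis using d by (simp add: mult.commute)
  qed
  show "\<forall>k\<in>{1..r * s}. Suc ((Suc ((k - 1) mod s * r + (k - 1) div s) - 1) mod r * s +
      (Suc ((k - 1) mod s * r + (k - 1) div s) - 1) div r) = k"
    using bound[OF assms] by auto
  show "\<forall>k\<in>{1..r * s}. Suc ((Suc ((k - 1) mod r * s + (k - 1) div r) - 1) mod s * r +
      (Suc ((k - 1) mod r * s + (k - 1) div r) - 1) div s) = k"
    using bound[OF assms(2,1)] by (auto simp: mult.commute)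
  show "(\<lambda>k. Suc ((k - 1) mod s * r + (k - 1) div s)) ` {1..r * s} \<subseteq> {1..r * s}"
    using bound[OF assms] by blast
  show "(\<lambda>k. Suc ((k - 1) mod r * s + (k - 1) div r)) ` {1..r * s} \<subseteq> {1..r * s}"
    using bound[OF assms(2,1)] by (auto simp: mult.commute)
qed

context expansive_group
begin

text \<open>Factor number \<open>j * s + i + 1\<close> of one refinement and number
  \<open>i * r + j + 1\<close> of the other come from the same pair of steps, \<open>j\<close> of
  \<open>S\<close> and \<open>i\<close> of \<open>S'\<close>, to which
  \<open>layers_co_commensurable\<close> applies.\<close>

lemma refine_equivalent:
  assumes S: "subnormal_series G X \<alpha> S r" and S': "subnormal_series G X \<alpha> S' s"
    and r: "0 < r" and s: "0 < s"
  shows "equivalent_series G X \<alpha> (refine S r S' s) (r * s) (refine S' s S r) (s * r)"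
proof -
  note SD = subnormal_series_steps[OF S] and SD' = subnormal_series_steps[OF S']
  let ?f = "\<lambda>k. Suc ((k - 1) mod s * r + (k - 1) div s)"
  \<comment> \<open>The identity outside the index range is what \<open>permutes\<close>
    requires.\<close>
  define \<pi> where "\<pi> k = (if k \<in> {1..r * s} then ?f k else k)" for k
  have "bij_betw \<pi> {1..r * s} {1..r * s} = bij_betw ?f {1..r * s} {1..r * s}"
    by (rule bij_betw_cong) (simp add: \<pi>_def)
  then have "bij_betw \<pi> {1..r * s} {1..r * s}"
    using transpose_index_bij[OF r s] by (rule iffD2)
  then have "\<pi> permutes {1..r * s}"
    by (rule bij_imp_permutes) (auto simp: \<pi>_def)
  moreover have "co_commensurable
      (sq_group G (refine S r S' s) k) (sq_top G X (refine S r S' s) k) (sq_map \<alpha>)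
      (sq_group G (refine S' s S r) (\<pi> k)) (sq_top G X (refine S' s S r) (\<pi> k)) (sq_map \<alpha>)"
    if k: "k \<in> {1..r * s}" for k
  proof -
    define j i where "j = (k - 1) div s" and "i = (k - 1) mod s"
    have "k - 1 < r * s" using k by auto
    then have ji: "j < r" "i < s" "k - 1 = j * s + i" "k = j * s + Suc i"
      using k s less_mult_imp_div_less[of "k - 1" r s] by (simp_all add: j_def i_def)
    have \<pi>k: "\<pi> k = i * r + Suc j" "\<pi> k - 1 = i * r + j"
      using k by (simp_all add: \<pi>_def j_def i_def)
    have R: "refine S r S' s (k - 1) = layer (S j) (S (Suc j)) (S' i)"
      "refine S r S' s k = layer (S j) (S (Suc j)) (S' (Suc i))"
      using ji(2) refine_eq[OF S S' ji(1) _ s, of i] refine_eq[OF S S' ji(1) _ s, of "Suc i"]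
      unfolding ji(3) unfolding ji(4) by simp_all
    have R': "refine S' s S r (\<pi> k - 1) = layer (S' i) (S' (Suc i)) (S j)"
      "refine S' s S r (\<pi> k) = layer (S' i) (S' (Suc i)) (S (Suc j))"
      using ji(1) refine_eq[OF S' S ji(2) _ r, of j] refine_eq[OF S' S ji(2) _ r, of "Suc j"]
      unfolding \<pi>k by simp_all
    show ?thesis
      unfolding sq_group_def sq_top_def R R'
      using SD(4)[OF ji(1)] SD'(4)[OF ji(2)] by (rule layers_co_commensurable)
  qed
  ultimately show ?thesis
    unfolding equivalent_series_def by (auto simp: mult.commute)
qed

text \<open>This handles series of length 0, for which the blocks of \<open>refine\<close>
  degenerate: \<open>G\<close> is then trivial, all terms of any series coincide, and the series of
  length 0 refines it.\<close>

lemma series_of_trivial_group: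
  assumes S: "subnormal_series G X \<alpha> S r" and triv: "carrier G = {\<one>}"
  shows "refines_series G X \<alpha> (\<lambda>_. {\<one>}) 0 S r"
proof -
  note SD = subnormal_series_steps[OF S]
  have "subnormal_series G X \<alpha> (\<lambda>_. {\<one>}) 0"
    using triv SD(1) SD(3)[of 0] by (intro subnormal_seriesI) auto
  moreover have "S i = {\<one>}" if "i \<le> r" for i
    using SD(3)[OF that] stableD(4,5)[of "S i"] triv unfolding self_nub_def by blast
  ultimately show ?thesis by (auto simp: refines_series_def)
qed

lemma equivalent_refinements:
  assumes S: "subnormal_series G X \<alpha> S r" and S': "subnormal_series G X \<alpha> S' s"
  shows "\<exists>R m R' m'. refines_series G X \<alpha> R m S r \<and> refines_series G X \<alpha> R' m' S' s \<and>
    equivalent_series G X \<alpha> R m R' m'"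
proof (cases "r = 0 \<or> s = 0")
  case True
  then have triv: "carrier G = {\<one>}"
    using subnormal_series_steps(1,2)[OF S] subnormal_series_steps(1,2)[OF S'] by auto
  have "equivalent_series G X \<alpha> (\<lambda>_. {\<one>}) 0 (\<lambda>_. {\<one>}) 0"
    unfolding equivalent_series_def by (auto intro: exI[of _ id] permutes_id)
  then show ?thesis
    using series_of_trivial_group[OF S triv] series_of_trivial_group[OF S' triv] by blast
next
  case False
  then show ?thesis
    using refine_refines[OF S S'] refine_refines[OF S' S] refine_equivalent[OF S S'] by blast
qed

end

section \<open>Passing from finite depth to an open normal subgroup\<close>

text \<open>\<open>N\<close> is the intersection of the conjugates of \<open>V\<close>. Conjugating
  by \<open>v \<otimes> t\<close> with \<open>v\<close> in \<open>V\<close> imposes the same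
  condition as conjugating by \<open>t\<close>, so one representative per right coset is enough;
  these are finitely many, and the intersection stays open.\<close>

lemma (in compact_topgroup) open_normal_core:
  assumes V: "subgroup V G" "openin X V"
  shows "\<exists>N. N \<lhd> G \<and> openin X N \<and> N \<subseteq> V"
proof -
  define N where "N = {x \<in> carrier G. \<forall>g\<in>carrier G. g \<otimes> x \<otimes> inv g \<in> V}"
  note V_simps = subgroup.m_closed[OF V(1)] subgroup.m_inv_closed[OF V(1)] subgroup.mem_carrier[OF V(1)]
  have "subgroup N G"
  proof (rule subgroupI)
    show "N \<subseteq> carrier G" by (auto simp: N_def)
    show "N \<noteq> {}" using subgroup.one_closed[OF V(1)] by (auto simp: N_def intro!: exI[of _ \<one>])
    show "inv x \<in> N" if "x \<in> N" for x
    proof -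
      have "g \<otimes> inv x \<otimes> inv g = inv (g \<otimes> x \<otimes> inv g)" if "g \<in> carrier G" for g
        using that \<open>x \<in> N\<close> by (simp add: N_def inv_mult_group m_assoc)
      then show ?thesis using that V_simps by (simp add: N_def)
    qed
    show "x \<otimes> y \<in> N" if "x \<in> N" "y \<in> N" for x y
    proof -
      have "g \<otimes> (x \<otimes> y) \<otimes> inv g = (g \<otimes> x \<otimes> inv g) \<otimes> (g \<otimes> y \<otimes> inv g)" if "g \<in> carrier G" for g
        using that \<open>x \<in> N\<close> \<open>y \<in> N\<close> by (simp add: N_def m_assoc inv_mult_cancel)
      then show ?thesis using that V_simps by (simp add: N_def)
    qed
  qed
  moreover have "h \<otimes> x \<otimes> inv h \<in> N" if "h \<in> carrier G" "x \<in> N" for h x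
  proof -
    have "g \<otimes> (h \<otimes> x \<otimes> inv h) \<otimes> inv g = (g \<otimes> h) \<otimes> x \<otimes> inv (g \<otimes> h)" if "g \<in> carrier G" for g
      using that \<open>h \<in> carrier G\<close> \<open>x \<in> N\<close> by (simp add: N_def m_assoc inv_mult_group)
    then show ?thesis using that by (simp add: N_def)
  qed
  ultimately have normal: "N \<lhd> G" by (simp add: normal_inv_iff)
  have "N \<subseteq> V"
  proof
    fix x assume "x \<in> N"
    then have "\<one> \<otimes> x \<otimes> inv \<one> \<in> V" "x \<in> carrier G" unfolding N_def by blast+
    then show "x \<in> V" by simp
  qed
  obtain T where T: "finite T" "T \<subseteq> carrier G" "(\<lambda>g. V #> g) ` carrier G = (\<lambda>g. V #> g) ` T"
  proof -
    have "(\<lambda>g. V #> g) ` carrier G = rcosets V" by (auto simp: RCOSETS_def)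
    then have "finite ((\<lambda>g. V #> g) ` carrier G)"
      using finite_rcosets_open[OF V] by simp
    then show ?thesis using that finite_subset_image by (metis subset_refl)
  qed
  have "N = carrier G \<inter> (\<Inter>t\<in>T. {x \<in> topspace X. t \<otimes> x \<otimes> inv t \<in> V})"
  proof (intro equalityI subsetI)
    fix x assume x: "x \<in> carrier G \<inter> (\<Inter>t\<in>T. {x \<in> topspace X. t \<otimes> x \<otimes> inv t \<in> V})"
    have "g \<otimes> x \<otimes> inv g \<in> V" if g: "g \<in> carrier G" for g
    proof -
      obtain t where t: "t \<in> T" "V #> g = V #> t" using T(3) g by blast
      then have "g \<in> V #> t" using rcos_self[OF g V(1)] by simp
      then obtain v where v: "v \<in> V" "g = v \<otimes> t" by (auto simp: r_coset_def)
      have "g \<otimes> x \<otimes> inv g = v \<otimes> (t \<otimes> x \<otimes> inv t) \<otimes> inv v"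
        using v t(1) T(2) x V_simps(3) by (simp add: subset_iff m_assoc inv_mult_group)
      moreover have "t \<otimes> x \<otimes> inv t \<in> V" using x t(1) by blast
      ultimately show ?thesis using v(1) V_simps by simp
    qed
    then show "x \<in> N" using x by (simp add: N_def)
  qed (use T(2) in \<open>auto simp: N_def\<close>)
  moreover have "openin X {x \<in> topspace X. t \<otimes> x \<otimes> inv t \<in> V}" if "t \<in> T" for t
    using that T(2)
    by (intro openin_continuous_map_preimage[OF _ V(2)] continuous_mult) auto
  \<comment> \<open>The factor \<open>carrier G\<close> takes care of an empty \<open>T\<close>,
    over which the bare intersection would be the whole type.\<close>
  then have "openin X (carrier G \<inter> (\<Inter>t\<in>T. {x \<in> topspace X. t \<otimes> x \<otimes> inv t \<in> V}))"
    using T(1) openin_topspace[of X]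
    by (cases "T = {}") (auto intro!: openin_Int openin_Inter)
  ultimately show ?thesis using normal \<open>N \<subseteq> V\<close> by auto
qed

theorem theorem6p19:
  fixes G :: "('a, 'm) monoid_scheme" and X :: "'a topology" and \<alpha> :: "'a \<Rightarrow> 'a"
    and S S' :: "nat \<Rightarrow> 'a set" and r r' :: nat
  assumes "topgroup G X" and "compact_space X" and "topaut G X \<alpha>"
    and "top_transitive X \<alpha>" and "finite_depth G X \<alpha>"
    and "subnormal_series G X \<alpha> S r" and "subnormal_series G X \<alpha> S' r'"
  shows "\<exists>R m R' m'. refines_series G X \<alpha> R m S r \<and> refines_series G X \<alpha> R' m' S' r' \<and>
           equivalent_series G X \<alpha> R m R' m'"
proof -
  interpret group G using assms(1) by (simp add: topgroup_def)
  interpret compact_topgroup G X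
    using assms(1,2) by unfold_locales
  obtain V where V: "subgroup V G" "openin X V"
    and depth: "(\<Inter>k::int. zpow_map (carrier G) \<alpha> k ` V) = {\<one>\<^bsub>G\<^esub>}"
    using assms(5) unfolding finite_depth_def by blast
  \<comment> \<open>Shrinking \<open>V\<close> to its core can only shrink the intersection of the
    translates, which still contains the identity.\<close>
  obtain N where N: "N \<lhd> G" "openin X N" "N \<subseteq> V"
    using open_normal_core[OF V] by blast
  have bij: "bij_betw \<alpha> (carrier G) (carrier G)"
    and hom: "\<alpha> \<in> hom G G"
    using assms(3) by (simp_all add: topaut_def iso_def)
  have one: "zpow_map (carrier G) \<alpha> k \<one>\<^bsub>G\<^esub> = \<one>\<^bsub>G\<^esub>" for k
    using zpow_map_unique[OF bij, of "\<lambda>_. \<one>\<^bsub>G\<^esub>" k] hom_one[OF hom is_group is_group] by simp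
  have "\<one>\<^bsub>G\<^esub> \<in> N" using N(1) by (simp add: normal_def subgroup.one_closed)
  then have "\<one>\<^bsub>G\<^esub> \<in> zpow_map (carrier G) \<alpha> k ` N" for k
    using imageI[of "\<one>\<^bsub>G\<^esub>" N "zpow_map (carrier G) \<alpha> k"] one by simp
  then have "{\<one>\<^bsub>G\<^esub>} \<subseteq> (\<Inter>k::int. zpow_map (carrier G) \<alpha> k ` N)"
    by (intro INT_greatest) simp
  moreover have "(\<Inter>k::int. zpow_map (carrier G) \<alpha> k ` N) \<subseteq> {\<one>\<^bsub>G\<^esub>}"
    unfolding depth[symmetric] using N(3) by (intro INF_superset_mono image_mono subset_refl)
  ultimately have "(\<Inter>k::int. zpow_map (carrier G) \<alpha> k ` N) = {\<one>\<^bsub>G\<^esub>}"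
    by (rule equalityI[rotated])
  then interpret expansive_group G X \<alpha> N
    using assms(3) N
    by (intro expansive_group.intro compact_topgroup_axioms expansive_group_axioms.intro)
  show ?thesis using assms(6,7) by (rule equivalent_refinements)
qed

end
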